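(* Let $\mathfrak n$ be the $7$-dimensional nilpotent Lie algebra with basis $\{e_1,\dots,e_7\}$ and Lie bracket $[e_1,e_2]=-e_5$, $[e_1,e_3]=-e_6$ (all other brackets of basis vectors being zero up to skew-symmetry), and let $N$ be the simply connected Lie group with Lie algebra $\mathfrak n$. Let $\varphi$ be the left-invariant $G_2$-structure on $N$ determined by the positive $3$-form $$\varphi=e^{147}+e^{267}+e^{357}+e^{123}+e^{156}+e^{245}-e^{346}.$$ Then $\varphi$ is closed, $D:=-\mathrm{Diag}(1,1,1,2,2,2,2)$ (with respect to $\{e_i\}$) is a derivation of $\mathfrak n$, and $$\Delta_\varphi\varphi=5\varphi+\mathcal L_{X_D}\varphi .$$ In particular $(N,\varphi)$ is an expanding soliton for the Laplacian flow $\frac{\partial}{\partial t}\varphi(t)=\Delta_{\varphi(t)}\varphi(t)$. Moreover $\varphi$ is not an eigenvector of $\Delta_\varphi$.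
   Context: $\{e^i\}$ is the dual basis of $\{e_i\}$ (regarded as left-invariant $1$-forms on $N$) and $e^{ijk}:=e^i\wedge e^j\wedge e^k$. A $G_2$-structure on a $7$-manifold is a $3$-form which is positive, i.e. on each tangent space it can be written, in some basis, as $e^{127}+e^{347}+e^{567}+e^{135}-e^{146}-e^{236}-e^{245}$; it determines a Riemannian metric $g_\varphi$ and an orientation (for which such a basis is orthonormal and oriented). For the $\varphi$ of the claim the basis $\{e_1,\dots,e_7\}$ is orthonormal for $g_\varphi$. $\Delta_\varphi$ is the Hodge Laplacian of $g_\varphi$; on $3$-forms $\Delta_\varphi=-d\ast d\ast+\ast d\ast d$. The exterior derivative on left-invariant forms is determined by $de^5=e^{12}$, $de^6=e^{13}$, $de^i=0$ otherwise. $X_D$ is the vector field on $N$ generated by the one-parameter group of automorphisms $F_t\in\mathrm{Aut}(N)$ with derivative $e^{tD}\in\mathrm{Aut}(\mathfrak n)$ at the identity: $X_D(p)=\frac{d}{dt}|_0F_t(p)$, and $\mathcal L$ is the Lie derivative. A soliton for the Laplacian flow is a $G_2$-structure with $\Delta_\varphi\varphi=k\varphi+\mathcal L_X\varphi$ for some $k\in\mathbb R$ and complete vector field $X$; it is expanding if $k>0$. *)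

theory Defs
  imports "HOL-Analysis.Analysis"
begin

section \<open>Forms on the manifold \<open>\<real>\<^sup>7\<close>\<close>

text \<open>
  A \<open>k\<close>-covector takes a list of vectors, is alternating and multilinear on lists of length
  \<open>k\<close>, and is zero on lists of any other length.  With this convention equality of \<open>k\<close>-forms is
  equality of functions, and all the operators below respect it.
  The index type \<open>7\<close> has the elements \<open>1, \<dots>, 7\<close>, where \<open>7 = 0\<close>.
\<close>

type_synonym vec7 = "real^7"
type_synonym covector = "vec7 list \<Rightarrow> real"
type_synonym dform = "vec7 \<Rightarrow> covector"

definition is_covector :: "nat \<Rightarrow> covector \<Rightarrow> bool" where
  "is_covector k \<alpha> \<longleftrightarrow>
     (\<forall>vs. length vs \<noteq> k \<longrightarrow> \<alpha> vs = 0) \<and>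
     (\<forall>vs i. length vs = k \<and> i < k \<longrightarrow> linear (\<lambda>x. \<alpha> (vs[i := x]))) \<and>
     (\<forall>vs i j. length vs = k \<and> i < j \<and> j < k \<and> vs ! i = vs ! j \<longrightarrow> \<alpha> vs = 0)"

fun Ck :: "nat \<Rightarrow> ('a::real_normed_vector \<Rightarrow> 'b::real_normed_vector) \<Rightarrow> bool" where
  "Ck 0 f \<longleftrightarrow> continuous_on UNIV f"
| "Ck (Suc k) f \<longleftrightarrow> (\<forall>x. f differentiable at x) \<and> (\<forall>v. Ck k (\<lambda>x. frechet_derivative f (at x) v))"

definition smooth :: "('a::real_normed_vector \<Rightarrow> 'b::real_normed_vector) \<Rightarrow> bool" where
  "smooth f \<longleftrightarrow> (\<forall>k. Ck k f)"

definition is_form :: "nat \<Rightarrow> dform \<Rightarrow> bool" where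
  "is_form k \<omega> \<longleftrightarrow> (\<forall>p. is_covector k (\<omega> p)) \<and> (\<forall>vs. smooth (\<lambda>p. \<omega> p vs))"

text \<open>Wedge product of \<open>1\<close>-covectors, normalised so that \<open>e\<^sup>1\<^sup>2(e\<^sub>1, e\<^sub>2) = 1\<close>.\<close>

definition wedge :: "(vec7 \<Rightarrow> real) list \<Rightarrow> covector" where
  "wedge \<theta>s vs =
     (if length vs = length \<theta>s
      then (\<Sum>\<sigma> | \<sigma> permutes {..<length \<theta>s}.
              of_int (sign \<sigma>) * (\<Prod>i<length \<theta>s. (\<theta>s ! i) (vs ! \<sigma> i)))
      else 0)"

text \<open>
  The exterior derivative: Cartan's formula on the (commuting) constant vector fields
  \<open>v\<^sub>0, \<dots>, v\<^sub>k\<close>.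
\<close>

definition ext_d :: "dform \<Rightarrow> dform" where
  "ext_d \<omega> p vs =
     (\<Sum>i<length vs. (-1) ^ i *
        frechet_derivative (\<lambda>q. \<omega> q (take i vs @ drop (Suc i) vs)) (at p) (vs ! i))"

definition closed_form :: "dform \<Rightarrow> bool" where
  "closed_form \<omega> \<longleftrightarrow> ext_d \<omega> = (\<lambda>p vs. 0)"


section \<open>Vector fields and Lie derivatives\<close>

definition integral_curve :: "(vec7 \<Rightarrow> vec7) \<Rightarrow> (real \<Rightarrow> vec7) \<Rightarrow> bool" where
  "integral_curve X \<gamma> \<longleftrightarrow> (\<forall>t. (\<gamma> has_vector_derivative X (\<gamma> t)) (at t))"

definition complete_vector_field :: "(vec7 \<Rightarrow> vec7) \<Rightarrow> bool" where
  "complete_vector_field X \<longleftrightarrow> smooth X \<and> (\<forall>p. \<exists>\<gamma>. integral_curve X \<gamma> \<and> \<gamma> 0 = p)"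

text \<open>The flow and the Lie derivative are only meaningful for a complete vector field.\<close>

definition flow :: "(vec7 \<Rightarrow> vec7) \<Rightarrow> real \<Rightarrow> vec7 \<Rightarrow> vec7" where
  "flow X t p = (THE \<gamma>. integral_curve X \<gamma> \<and> \<gamma> 0 = p) t"

definition pullback :: "(vec7 \<Rightarrow> vec7) \<Rightarrow> dform \<Rightarrow> dform" where
  "pullback F \<omega> p vs = \<omega> (F p) (map (frechet_derivative F (at p)) vs)"

definition lie_derivative :: "(vec7 \<Rightarrow> vec7) \<Rightarrow> dform \<Rightarrow> dform" where
  "lie_derivative X \<omega> p vs = deriv (\<lambda>t. pullback (flow X t) \<omega> p vs) 0"

definition vf_bracket :: "(vec7 \<Rightarrow> vec7) \<Rightarrow> (vec7 \<Rightarrow> vec7) \<Rightarrow> vec7 \<Rightarrow> vec7" where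
  "vf_bracket X Y p = frechet_derivative Y (at p) (X p) - frechet_derivative X (at p) (Y p)"


section \<open>\<open>G\<^sub>2\<close>-structures\<close>

definition g2_model :: "(7 \<Rightarrow> vec7 \<Rightarrow> real) \<Rightarrow> covector" where
  "g2_model \<theta> vs =
     (let w = (\<lambda>is. wedge (map \<theta> is) vs) in
        w [1,2,7] + w [3,4,7] + w [5,6,7] + w [1,3,5] - w [1,4,6] - w [2,3,6] - w [2,4,5])"

text \<open>Having a dual family, seven vectors \<open>b\<close> automatically form a basis.\<close>

definition adapted_basis :: "covector \<Rightarrow> (7 \<Rightarrow> vec7) \<Rightarrow> bool" where
  "adapted_basis \<alpha> b \<longleftrightarrow>
     (\<exists>\<theta>. (\<forall>i. linear (\<theta> i)) \<and> (\<forall>i j. \<theta> i (b j) = (if i = j then 1 else 0)) \<and>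
          \<alpha> = g2_model \<theta>)"

definition g2_structure :: "dform \<Rightarrow> bool" where
  "g2_structure \<phi> \<longleftrightarrow> is_form 3 \<phi> \<and> (\<forall>p. \<exists>b. adapted_basis (\<phi> p) b)"

definition orthonormal_basis :: "(vec7 \<Rightarrow> vec7 \<Rightarrow> real) \<Rightarrow> (7 \<Rightarrow> vec7) \<Rightarrow> bool" where
  "orthonormal_basis g b \<longleftrightarrow> (\<forall>i j. g (b i) (b j) = (if i = j then 1 else 0))"

text \<open>
  The metric and the oriented volume form determined by a positive \<open>3\<close>-covector: those for
  which every adapted basis is orthonormal and oriented.
\<close>

definition g2_metric :: "covector \<Rightarrow> vec7 \<Rightarrow> vec7 \<Rightarrow> real" where
  "g2_metric \<alpha> = (THE g. bilinear g \<and> (\<forall>b. adapted_basis \<alpha> b \<longrightarrow> orthonormal_basis g b))"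

definition g2_volume :: "covector \<Rightarrow> covector" where
  "g2_volume \<alpha> =
     (THE \<mu>. is_covector 7 \<mu> \<and> (\<forall>b. adapted_basis \<alpha> b \<longrightarrow> \<mu> (map b [1,2,3,4,5,6,7]) = 1))"

text \<open>
  The Hodge star of a metric \<open>g\<close> with volume form \<open>\<mu>\<close>, in the index notation
  \<open>(\<star>\<beta>)\<^sub>J = 1/k! \<Sum>\<^sub>I \<beta>\<^sub>I \<mu>\<^sub>I\<^sub>J\<close> with respect to an orthonormal basis (on whose choice the result
  does not depend); so \<open>\<star>(b\<^sup>1 \<and> \<dots> \<and> b\<^sup>k) = b\<^sup>k\<^sup>+\<^sup>1 \<and> \<dots> \<and> b\<^sup>7\<close> for oriented orthonormal \<open>b\<close>.
\<close>

definition hodge :: "(vec7 \<Rightarrow> vec7 \<Rightarrow> real) \<Rightarrow> covector \<Rightarrow> covector \<Rightarrow> covector" where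
  "hodge g \<mu> \<beta> ws =
     (let b = (SOME b. orthonormal_basis g b); k = 7 - length ws in
        1 / fact k * (\<Sum>is | length is = k. \<beta> (map b is) * \<mu> (map b is @ ws)))"

definition hodge_star :: "dform \<Rightarrow> dform \<Rightarrow> dform" where
  "hodge_star \<phi> \<omega> p = hodge (g2_metric (\<phi> p)) (g2_volume (\<phi> p)) (\<omega> p)"

text \<open>The Hodge Laplacian on \<open>3\<close>-forms; the signs are specific to this degree.\<close>

definition laplacian :: "dform \<Rightarrow> dform \<Rightarrow> dform" where
  "laplacian \<phi> \<omega> p vs =
     - ext_d (hodge_star \<phi> (ext_d (hodge_star \<phi> \<omega>))) p vs
     + hodge_star \<phi> (ext_d (hodge_star \<phi> (ext_d \<omega>))) p vs"

definition laplacian_soliton :: "dform \<Rightarrow> real \<Rightarrow> (vec7 \<Rightarrow> vec7) \<Rightarrow> bool" where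
  "laplacian_soliton \<phi> k X \<longleftrightarrow>
     g2_structure \<phi> \<and> complete_vector_field X \<and>
     laplacian \<phi> \<phi> = (\<lambda>p vs. k * \<phi> p vs + lie_derivative X \<phi> p vs)"

definition expanding_soliton :: "dform \<Rightarrow> bool" where
  "expanding_soliton \<phi> \<longleftrightarrow> (\<exists>k X. k > 0 \<and> laplacian_soliton \<phi> k X)"


section \<open>The nilpotent Lie algebra and its simply connected Lie group\<close>

abbreviation e :: "7 \<Rightarrow> vec7" where
  "e i \<equiv> axis i 1"

definition n_bracket :: "vec7 \<Rightarrow> vec7 \<Rightarrow> vec7" where
  "n_bracket x y =
     - (x $ 1 * y $ 2 - x $ 2 * y $ 1) *\<^sub>R e 5 - (x $ 1 * y $ 3 - x $ 3 * y $ 1) *\<^sub>R e 6"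

definition derivation :: "real^7^7 \<Rightarrow> bool" where
  "derivation A \<longleftrightarrow>
     (\<forall>x y. A *v n_bracket x y = n_bracket (A *v x) y + n_bracket x (A *v y))"

text \<open>
  The group \<open>N\<close> is \<open>\<real>\<^sup>7\<close> (hence simply connected) with the Baker-Campbell-Hausdorff product,
  which for this 2-step nilpotent algebra stops at the first bracket.  The lemmas below confirm
  that it is a Lie group whose left-invariant vector fields have the Lie bracket of the algebra.
\<close>

definition N_mult :: "vec7 \<Rightarrow> vec7 \<Rightarrow> vec7" where
  "N_mult p q = p + q + (1/2) *\<^sub>R n_bracket p q"

definition N_inv :: "vec7 \<Rightarrow> vec7" where
  "N_inv p = - p"

definition left_inv_vf :: "vec7 \<Rightarrow> vec7 \<Rightarrow> vec7" where
  "left_inv_vf v p = frechet_derivative (N_mult p) (at 0) v"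

lemma N_mult_assoc: "N_mult (N_mult p q) r = N_mult p (N_mult q r)"
  unfolding N_mult_def n_bracket_def vec_eq_iff
  by (simp add: axis_def algebra_simps)

lemma N_mult_0: "N_mult 0 p = p" "N_mult p 0 = p"
  by (simp_all add: N_mult_def n_bracket_def)

lemma N_mult_inv: "N_mult (N_inv p) p = 0" "N_mult p (N_inv p) = 0"
  by (simp_all add: N_mult_def N_inv_def n_bracket_def algebra_simps)

lemma linear_n_bracket: "linear (n_bracket x)" "linear (\<lambda>x. n_bracket x y)"
  by (auto intro!: linearI simp: n_bracket_def algebra_simps scaleR_add_left)

lemma N_mult_has_derivative:
  "(N_mult p has_derivative (\<lambda>v. v + (1/2) *\<^sub>R n_bracket p v)) (at q)"
proof -
  have "(n_bracket p has_derivative n_bracket p) (at q)"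
    by (intro linear_imp_has_derivative linear_n_bracket)
  then show ?thesis
    unfolding N_mult_def by (auto intro!: derivative_eq_intros)
qed

lemma left_inv_vf: "left_inv_vf v p = v + (1/2) *\<^sub>R n_bracket p v"
  unfolding left_inv_vf_def
  using frechet_derivative_at[OF N_mult_has_derivative] by metis

lemma Lie_algebra_N: "vf_bracket (left_inv_vf x) (left_inv_vf y) = left_inv_vf (n_bracket x y)"
proof -
  have fd: "frechet_derivative (left_inv_vf v) (at p) = (\<lambda>w. (1/2) *\<^sub>R n_bracket w v)" for v p
  proof -
    have "((\<lambda>p. n_bracket p v) has_derivative (\<lambda>p. n_bracket p v)) (at p)"
      by (intro linear_imp_has_derivative linear_n_bracket)
    then have "(left_inv_vf v has_derivative (\<lambda>w. (1/2) *\<^sub>R n_bracket w v)) (at p)"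
      unfolding left_inv_vf by (auto intro!: derivative_eq_intros)
    from frechet_derivative_at[OF this] show ?thesis by simp
  qed
  show ?thesis
    by (rule ext) (simp add: vf_bracket_def fd left_inv_vf n_bracket_def vec_eq_iff axis_def
        algebra_simps)
qed

lemma Ck_const: "Ck k (\<lambda>x. c)"
  by (induction k arbitrary: c) (auto simp: frechet_derivative_const)

lemma Ck_linear_plus_const:
  fixes f :: "'a::euclidean_space \<Rightarrow> 'b::real_normed_vector"
  assumes "linear f"
  shows "Ck k (\<lambda>x. f x + c)"
proof -
  have f: "bounded_linear f"
    using assms linear_conv_bounded_linear by blast
  have d: "((\<lambda>x. f x + c) has_derivative f) (at x)" for x
    using f by (auto intro!: derivative_eq_intros bounded_linear_imp_has_derivative)
  show ?thesis
  proof (cases k)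
    case 0
    then show ?thesis
      using linear_continuous_on[OF f] by (auto intro!: continuous_on_add continuous_on_const)
  next
    case (Suc m)
    then show ?thesis
      using d frechet_derivative_at[OF d, symmetric]
      by (auto simp: differentiable_def intro!: Ck_const)
  qed
qed

lemma N_mult_smooth: "smooth (\<lambda>z. N_mult (fst z) (snd z))"
proof -
  let ?B = "\<lambda>z w. fst w + snd w + (1/2) *\<^sub>R (n_bracket (fst w) (snd z) + n_bracket (fst z) (snd w))"
  have bb: "bounded_bilinear n_bracket"
    unfolding bilinear_conv_bounded_bilinear[symmetric] bilinear_def
    using linear_n_bracket by blast
  have d: "((\<lambda>z. N_mult (fst z) (snd z)) has_derivative ?B z) (at z)" for z
    unfolding N_mult_def
    by (auto intro!: derivative_eq_intros bounded_bilinear.FDERIV[OF bb] simp: algebra_simps)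
  have B: "Ck k (\<lambda>z. ?B z w)" for k w
  proof -
    have "linear (\<lambda>z. (1/2) *\<^sub>R (n_bracket (fst w) (snd z) + n_bracket (fst z) (snd w)))"
      by (rule linearI) (auto simp: n_bracket_def algebra_simps)
    from Ck_linear_plus_const[OF this, of k "fst w + snd w"] show ?thesis
      by (simp add: add.commute)
  qed
  have "Ck k (\<lambda>z. N_mult (fst z) (snd z))" for k
  proof (cases k)
    case 0
    then show ?thesis
      using has_derivative_continuous[OF d] by (simp add: continuous_at_imp_continuous_on)
  next
    case (Suc m)
    then show ?thesis
      using d frechet_derivative_at[OF d, symmetric] B by (auto simp: differentiable_def)
  qed
  then show ?thesis
    by (simp add: smooth_def)
qed

lemma N_inv_smooth: "smooth N_inv"
proof -
  have "linear (\<lambda>p :: vec7. - p)"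
    by (simp add: linear_iff)
  from Ck_linear_plus_const[OF this, of _ 0] show ?thesis
    unfolding smooth_def N_inv_def by simp
qed

definition left_inv_form :: "covector \<Rightarrow> dform" where
  "left_inv_form \<alpha> p vs = \<alpha> (map (frechet_derivative (N_mult (N_inv p)) (at p)) vs)"

definition N_aut :: "(vec7 \<Rightarrow> vec7) \<Rightarrow> bool" where
  "N_aut F \<longleftrightarrow> bij F \<and> smooth F \<and> smooth (inv F) \<and>
     (\<forall>p q. F (N_mult p q) = N_mult (F p) (F q))"

fun mat_pow :: "real^'n^'n \<Rightarrow> nat \<Rightarrow> real^'n^'n" where
  "mat_pow A 0 = mat 1"
| "mat_pow A (Suc k) = A ** mat_pow A k"

definition mat_exp :: "real^'n^'n \<Rightarrow> real^'n^'n" where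
  "mat_exp A = (\<Sum>k. (1 / fact k) *\<^sub>R mat_pow A k)"

text \<open>
  \<open>aut_of A t\<close> is the automorphism of \<open>N\<close> with derivative \<open>exp (t A)\<close> at the identity \<open>0\<close>
  (for a derivation \<open>A\<close> it exists and is unique because \<open>N\<close> is simply connected).
\<close>

definition aut_of :: "real^7^7 \<Rightarrow> real \<Rightarrow> vec7 \<Rightarrow> vec7" where
  "aut_of A t = (THE F. N_aut F \<and> (F has_derivative (\<lambda>v. mat_exp (t *\<^sub>R A) *v v)) (at 0))"

definition vf_of :: "real^7^7 \<Rightarrow> vec7 \<Rightarrow> vec7" where
  "vf_of A p = vector_derivative (\<lambda>t. aut_of A t p) (at 0)"

definition diag_mat :: "real^'n \<Rightarrow> real^'n^'n" where
  "diag_mat d = (\<chi> i j. if i = j then d $ i else 0)"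

definition D_n :: "real^7^7" where
  "D_n = - diag_mat (vector [1,1,1,2,2,2,2])"

definition phi_n :: covector where
  "phi_n vs =
     (let w = (\<lambda>is. wedge (map (\<lambda>i v. v $ i) is) vs) in
        w [1,4,7] + w [2,6,7] + w [3,5,7] + w [1,2,3] + w [1,5,6] + w [2,4,5] - w [3,4,6])"

definition phi_N :: dform where
  "phi_N = left_inv_form phi_n"

end

theory Submission
  imports Defs "Jordan_Normal_Form.Determinant"
begin

text \<open>
  The identity \<open>\<iota>\<^sub>u\<phi> \<and> \<iota>\<^sub>u\<phi> \<and> \<phi> = 6 |u|\<^sup>2 vol\<close> has a left hand side that does not mention the adapted
  basis.  Comparing it for two adapted bases, whose metrics then differ by a factor \<open>D\<close> and whose
  volume forms differ by \<open>1/D\<close>, gives \<open>D\<^sup>9 = 1\<close>; so metric and orientation are determined by \<open>\<phi>\<close>.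

  The basis \<open>e\<^sub>1, e\<^sub>4, e\<^sub>2, e\<^sub>6, e\<^sub>3, e\<^sub>5, e\<^sub>7\<close> is adapted to the \<open>\<phi>\<close> of the theorem.  Left-invariant forms
  are integer combinations of \<open>e\<^sup>I\<close>, and on these \<open>d\<close> and \<open>\<star>\<close> are computed symbolically:
  \<open>d\<star>\<phi> = e\<^sup>1\<^sup>3\<^sup>4\<^sup>5\<^sup>7 - e\<^sup>1\<^sup>2\<^sup>4\<^sup>6\<^sup>7\<close>, \<open>\<star>d\<star>\<phi> = e\<^sup>3\<^sup>5 - e\<^sup>2\<^sup>6\<close> and \<open>\<Delta>\<phi> = 2 e\<^sup>1\<^sup>2\<^sup>3\<close>.  The flow of \<open>X\<^sub>D\<close> scales
  \<open>e\<^sup>1\<^sup>2\<^sup>3\<close> by \<open>exp (-3t)\<close> and the other terms of \<open>\<phi>\<close> by \<open>exp (-5t)\<close>, so \<open>5\<phi> + L\<^sub>X\<phi> = 2 e\<^sup>1\<^sup>2\<^sup>3\<close>.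
\<close>

section \<open>Wedge products as determinants\<close>

lemma permutes_lessThan: "\<sigma> permutes {..<n} \<Longrightarrow> i < n \<Longrightarrow> \<sigma> i < (n::nat)"
  using permutes_in_image by fastforce

lemma wedge_length: "length vs \<noteq> length \<theta>s \<Longrightarrow> wedge \<theta>s vs = 0"
  by (simp add: wedge_def)

text \<open>Rows belong to covectors and columns to vectors: expansion along row 0 peels off the
  first covector, expansion along column 0 the first vector.\<close>

definition eval_mat :: "(vec7 \<Rightarrow> real) list \<Rightarrow> vec7 list \<Rightarrow> real mat" where
  "eval_mat \<theta>s vs = Matrix.mat (length \<theta>s) (length vs) (\<lambda>(i, j). (\<theta>s ! i) (vs ! j))"

lemma eval_mat_carrier: "eval_mat \<theta>s vs \<in> carrier_mat (length \<theta>s) (length vs)"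
  by (simp add: eval_mat_def)

text \<open>The defining sum is the Leibniz formula. Matrices whose size is a term, not a type, give
  Laplace expansion for lists of any length.\<close>

lemma wedge_det:
  assumes "length vs = length \<theta>s"
  shows "wedge \<theta>s vs = Determinant.det (eval_mat \<theta>s vs)"
  using assms unfolding wedge_def Determinant.det_def eval_mat_def
  by (auto simp: lessThan_atLeast0 sign_def permutes_lessThan intro!: sum.cong prod.cong)

lemma wedge_Nil: "wedge [] [] = 1"
  by (simp add: wedge_det eval_mat_def)

text \<open>Laplace expansion along the first row. The sum has the shape of \<open>ext_d\<close>,
  with \<open>\<theta>\<close> in place of the derivative; \<open>ext_d_wedge\<close> relies on
  this.\<close>

lemma wedge_Cons:
  "wedge (\<theta> # \<theta>s) vs =
     (\<Sum>i<length vs. (-1) ^ i * \<theta> (vs ! i) * wedge \<theta>s (take i vs @ drop (Suc i) vs))"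
proof (cases "length vs = Suc (length \<theta>s)")
  case True
  let ?M = "eval_mat (\<theta> # \<theta>s) vs"
  have M: "?M \<in> carrier_mat (length vs) (length vs)"
    using True eval_mat_carrier[of "\<theta> # \<theta>s" vs] by simp
  have "wedge (\<theta> # \<theta>s) vs = (\<Sum>i<length vs. ?M $$ (0, i) * cofactor ?M 0 i)"
    using True M by (simp add: wedge_det laplace_expansion_row[of _ "length vs" 0])
  also have "\<dots> = (\<Sum>i<length vs. (-1) ^ i * \<theta> (vs ! i) * wedge \<theta>s (take i vs @ drop (Suc i) vs))"
  proof (intro sum.cong refl)
    fix i assume i: "i \<in> {..<length vs}"
    have "mat_delete ?M 0 i = eval_mat \<theta>s (take i vs @ drop (Suc i) vs)"
      by (rule eq_matI) (use i True in \<open>auto simp: mat_delete_def eval_mat_def nth_append min_def\<close>)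
    then show "?M $$ (0, i) * cofactor ?M 0 i
        = (-1) ^ i * \<theta> (vs ! i) * wedge \<theta>s (take i vs @ drop (Suc i) vs)"
      using i True by (subst wedge_det) (auto simp: cofactor_def eval_mat_def)
  qed
  finally show ?thesis .
next
  case False
  then show ?thesis by (auto simp: wedge_length intro!: sum.neutral[symmetric])
qed

text \<open>The column of \<open>v\<close> is the first unit vector, so the expansion along it
  leaves a single minor.\<close>

lemma wedge_Cons_dual:
  assumes "\<theta> v = 1" "\<forall>\<eta>\<in>set \<theta>s. \<eta> v = 0"
  shows "wedge (\<theta> # \<theta>s) (v # vs) = wedge \<theta>s vs"
proof (cases "length vs = length \<theta>s")
  case True
  let ?M = "eval_mat (\<theta> # \<theta>s) (v # vs)" and ?n = "Suc (length \<theta>s)"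
  have "wedge (\<theta> # \<theta>s) (v # vs) = (\<Sum>i<?n. ?M $$ (i, 0) * cofactor ?M i 0)"
    using True eval_mat_carrier[of "\<theta> # \<theta>s" "v # vs"]
    by (simp add: wedge_det laplace_expansion_column[of _ ?n 0])
  also have "\<dots> = (\<Sum>i<?n. if i = 0 then cofactor ?M 0 0 else 0)"
    using assms by (intro sum.cong refl) (auto simp: eval_mat_def nth_Cons')
  also have "\<dots> = cofactor ?M 0 0"
    by simp
  also have "mat_delete ?M 0 0 = eval_mat \<theta>s vs"
    by (rule eq_matI) (auto simp: mat_delete_def eval_mat_def)
  then have "cofactor ?M 0 0 = wedge \<theta>s vs"
    using True by (simp add: cofactor_def wedge_det)
  finally show ?thesis .
qed (simp add: wedge_length)

lemma wedge_swap:
  assumes "i < length \<theta>s" "j < length \<theta>s" "i \<noteq> j"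
  shows "wedge (\<theta>s[i := \<theta>s ! j, j := \<theta>s ! i]) vs = - wedge \<theta>s vs"
proof (cases "length vs = length \<theta>s")
  case True
  have "eval_mat (\<theta>s[i := \<theta>s ! j, j := \<theta>s ! i]) vs = swaprows i j (eval_mat \<theta>s vs)"
    using assms by (intro eq_matI) (auto simp: eval_mat_def nth_list_update)
  then show ?thesis
    using True assms eval_mat_carrier[of \<theta>s vs] by (simp add: wedge_det det_swaprows[of i "length vs"])
qed (simp add: wedge_length)

lemma wedge_swap_adjacent: "wedge (xs @ x # y # ys) vs = - wedge (xs @ y # x # ys) vs"
  using wedge_swap[of "length xs" "xs @ x # y # ys" "Suc (length xs)" vs]
  by (simp add: nth_append list_update_append)

lemma wedge_repeat: "wedge (xs @ x # x # ys) vs = 0"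
  using wedge_swap_adjacent[of xs x x ys vs] by simp

lemma prod_list_conv_prod_nth: "prod_list (map f xs) = (\<Prod>i<length xs. f (xs ! i))"
  by (simp add: prod.list_conv_set_nth lessThan_atLeast0)

lemma wedge_scale:
  "wedge (map (\<lambda>i v. c i * f i v) is) vs = (\<Prod>i\<leftarrow>is. c i) * wedge (map f is) vs"
  by (simp add: wedge_def prod.distrib sum_distrib_left mult.left_commute prod_list_conv_prod_nth)

lemma wedge_map: 
  "wedge \<theta>s (map F vs) = wedge (map (\<lambda>\<theta> v. \<theta> (F v)) \<theta>s) vs"
  unfolding wedge_def
  by (auto intro!: sum.cong prod.cong simp: permutes_lessThan)

text \<open>Isolates the one factor that comes from slot \<open>i\<close>, so that both linearity in
  this slot and the product rule can be read off.\<close>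

lemma wedge_slot:
  assumes "i < length \<theta>s" "length vs = length \<theta>s"
  shows "wedge (\<theta>s[i := \<eta>]) vs = (\<Sum>\<sigma> | \<sigma> permutes {..<length \<theta>s}.
    of_int (sign \<sigma>) * (\<eta> (vs ! \<sigma> i) * (\<Prod>j\<in>{..<length \<theta>s} - {i}. (\<theta>s ! j) (vs ! \<sigma> j))))"
proof -
  have "(\<Prod>j<length \<theta>s. (\<theta>s[i := \<eta>] ! j) (vs ! \<sigma> j))
     = \<eta> (vs ! \<sigma> i) * (\<Prod>j\<in>{..<length \<theta>s} - {i}. (\<theta>s ! j) (vs ! \<sigma> j))" for \<sigma>
    using assms by (subst prod.remove[of _ i]) (auto intro!: prod.cong)
  then show ?thesis
    using assms by (simp add: wedge_def)
qed

lemma wedge_add_slot: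
  assumes "i < length \<theta>s"
  shows "wedge (\<theta>s[i := (\<lambda>v. a * \<eta> v + b * \<zeta> v)]) vs
    = a * wedge (\<theta>s[i := \<eta>]) vs + b * wedge (\<theta>s[i := \<zeta>]) vs"
proof (cases "length vs = length \<theta>s")
  case True
  then show ?thesis
    using assms by (simp add: wedge_slot sum.distrib[symmetric] sum_distrib_left algebra_simps)
qed (simp add: wedge_length)

text \<open>Reindexing the sum by \<open>\<tau> \<circ> \<sigma>\<close> costs the factor
  \<open>sign \<tau>\<close>, because the sign is multiplicative and squares to 1.\<close>

lemma wedge_permute:
  assumes "\<tau> permutes {..<length vs}"
  shows "wedge \<theta>s (permute_list \<tau> vs) = of_int (sign \<tau>) * wedge \<theta>s vs"
proof (cases "length vs = length \<theta>s")
  case True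
  let ?n = "length \<theta>s"
  have \<tau>: "\<tau> permutes {..<?n}"
    using assms True by simp
  have "wedge \<theta>s (permute_list \<tau> vs) =
      (\<Sum>\<sigma> | \<sigma> permutes {..<?n}. of_int (sign \<sigma>) * (\<Prod>i<?n. (\<theta>s ! i) (vs ! \<tau> (\<sigma> i))))"
    using True assms unfolding wedge_def
    by (auto intro!: sum.cong prod.cong simp: permute_list_nth permutes_lessThan)
  also have "\<dots> = (\<Sum>\<sigma> | \<sigma> permutes {..<?n}. of_int (sign \<tau>) *
      (of_int (sign (\<tau> \<circ> \<sigma>)) * (\<Prod>i<?n. (\<theta>s ! i) (vs ! (\<tau> \<circ> \<sigma>) i))))"
  proof (intro sum.cong refl)
    fix \<sigma> assume "\<sigma> \<in> {\<sigma>. \<sigma> permutes {..<?n}}"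
    then have "sign (\<tau> \<circ> \<sigma>) = sign \<tau> * sign \<sigma>"
      using \<tau> by (intro sign_compose permutes_imp_permutation[of "{..<?n}"]) auto
    moreover have "sign \<tau> * sign \<tau> = 1"
      by (simp add: sign_def)
    then have "of_int (sign \<tau>) * of_int (sign \<tau>) = (1::real)"
      by (metis of_int_1 of_int_mult)
    ultimately show "of_int (sign \<sigma>) * (\<Prod>i<?n. (\<theta>s ! i) (vs ! \<tau> (\<sigma> i))) = of_int (sign \<tau>) *
      (of_int (sign (\<tau> \<circ> \<sigma>)) * (\<Prod>i<?n. (\<theta>s ! i) (vs ! (\<tau> \<circ> \<sigma>) i)))"
      by (simp add: mult.assoc[symmetric])
  qed
  also have "\<dots> = of_int (sign \<tau>) * wedge \<theta>s vs"
    using True setum_permutations_compose_left[OF \<tau>, symmetric,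
        of "\<lambda>\<sigma>. of_int (sign \<sigma>) * (\<Prod>i<?n. (\<theta>s ! i) (vs ! \<sigma> i))"]
    by (simp only: wedge_def sum_distrib_left[symmetric]) simp
  finally show ?thesis .
qed (simp add: wedge_length)

section \<open>Wedge products are alternating and multilinear\<close>

lemma linear_mult_left: "linear f \<Longrightarrow> linear (\<lambda>x. c * f x :: real)"
  by (auto intro!: linearI simp: linear_add linear_scale algebra_simps)

lemma linear_mult_right: "linear f \<Longrightarrow> linear (\<lambda>x. f x * c :: real)"
  using linear_mult_left[of f c] by (simp add: mult.commute)

lemma is_covector_wedge:
  assumes "\<forall>\<theta>\<in>set \<theta>s. linear \<theta>"
  shows "is_covector (length \<theta>s) (wedge \<theta>s)"
  unfolding is_covector_def
proof (intro conjI allI impI)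
  fix vs :: "vec7 list" and i assume vs: "length vs = length \<theta>s \<and> i < length \<theta>s"
  \<comment> \<open>The vector in slot \<open>i\<close> is read only by the covector whose index is
    the preimage of \<open>i\<close> under \<open>\<sigma>\<close>, so exactly one factor of each
    product depends on \<open>x\<close>.\<close>
  have "wedge \<theta>s (vs[i := x]) = (\<Sum>\<sigma> | \<sigma> permutes {..<length \<theta>s}. of_int (sign \<sigma>) *
     ((\<theta>s ! inv_into UNIV \<sigma> i) x * (\<Prod>j\<in>{..<length \<theta>s} - {inv_into UNIV \<sigma> i}. (\<theta>s ! j) (vs ! \<sigma> j))))" for x
  proof -
    have "(\<Prod>j<length \<theta>s. (\<theta>s ! j) (vs[i := x] ! \<sigma> j)) =
        (\<theta>s ! inv_into UNIV \<sigma> i) x * (\<Prod>j\<in>{..<length \<theta>s} - {inv_into UNIV \<sigma> i}. (\<theta>s ! j) (vs ! \<sigma> j))"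
      if \<sigma>: "\<sigma> permutes {..<length \<theta>s}" for \<sigma>
    proof -
      have "inv_into UNIV \<sigma> i < length \<theta>s" "\<sigma> (inv_into UNIV \<sigma> i) = i"
        using vs \<sigma> permutes_inv[OF \<sigma>] by (simp_all add: permutes_lessThan permutes_inverses)
      moreover have "i \<noteq> \<sigma> j" if "j \<noteq> inv_into UNIV \<sigma> i" for j
        using that \<sigma> by (auto simp: permutes_inverses)
      ultimately show ?thesis
        using vs by (subst prod.remove[of _ "inv_into UNIV \<sigma> i"])
            (auto intro!: prod.cong simp: nth_list_update_neq)
    qed
    then show ?thesis
      using vs by (simp add: wedge_def)
  qed
  moreover have "linear (\<theta>s ! inv_into UNIV \<sigma> i)" if "\<sigma> permutes {..<length \<theta>s}" for \<sigma>
    using assms vs permutes_inv[OF that] by (simp add: permutes_lessThan)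
  ultimately show "linear (\<lambda>x. wedge \<theta>s (vs[i := x]))"
    by (simp only:) (intro linear_compose_sum ballI linear_mult_left linear_mult_right, simp)
next
  fix vs :: "vec7 list" and i j
  assume vs: "length vs = length \<theta>s \<and> i < j \<and> j < length \<theta>s \<and> vs ! i = vs ! j"
  let ?\<tau> = "Transposition.transpose i j"
  have \<tau>: "?\<tau> permutes {..<length vs}"
    using vs by (intro permutes_swap_id) auto
  \<comment> \<open>Exchanging two equal vectors fixes the list but reverses the sign of the wedge
    product.\<close>
  have "permute_list ?\<tau> vs = vs"
    using vs by (intro nth_equalityI) (auto simp: permute_list_nth[OF \<tau>] Transposition.transpose_def)
  then have "wedge \<theta>s vs = - wedge \<theta>s vs"
    using wedge_permute[OF \<tau>, of \<theta>s] vs by (simp add: sign_swap_id)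
  then show "wedge \<theta>s vs = 0" by simp
qed (simp add: wedge_length)

section \<open>Signs of index lists\<close>

lemma exhaust_7: "x = 1 \<or> x = 2 \<or> x = 3 \<or> x = 4 \<or> x = 5 \<or> x = 6 \<or> x = (7::7)"
proof (induct x)
  case (of_int z)
  then have "z = 0 \<or> z = 1 \<or> z = 2 \<or> z = 3 \<or> z = 4 \<or> z = 5 \<or> z = 6" by fastforce
  then show ?case by auto
qed

lemma UNIV_7: "UNIV = {1, 2, 3, 4, 5, 6, 7::7}"
  using exhaust_7 by auto

lemma sum_7: "sum f (UNIV :: 7 set) = f 1 + f 2 + f 3 + f 4 + f 5 + f 6 + f 7"
  unfolding UNIV_7 by (simp add: ac_simps)

lemma forall_7: "(\<forall>i::7. P i) \<longleftrightarrow> P 1 \<and> P 2 \<and> P 3 \<and> P 4 \<and> P 5 \<and> P 6 \<and> P 7"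
  by (metis exhaust_7)

text \<open>Insertion that records the sign of the permutation. The sign 0 marks a repeated index,
  where the wedge product vanishes and the resulting list is irrelevant.\<close>

fun insert_sign :: "nat \<Rightarrow> nat list \<Rightarrow> int \<times> nat list" where
  "insert_sign x [] = (1, [x])"
| "insert_sign x (y # ys) =
     (if x < y then (1, x # y # ys) else if x = y then (0, x # y # ys)
      else case insert_sign x ys of (s, l) \<Rightarrow> (- s, y # l))"

fun sort_sign :: "nat list \<Rightarrow> int \<times> nat list" where
  "sort_sign [] = (1, [])"
| "sort_sign (x # xs) =
     (case sort_sign xs of (s, l) \<Rightarrow> case insert_sign x l of (t, m) \<Rightarrow> (s * t, m))"

text \<open>The prefix \<open>ys\<close> is arbitrary because, once \<open>x\<close> has passed
  \<open>y\<close>, the induction hypothesis is applied with prefix \<open>ys @ [y]\<close>.\<close>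

lemma wedge_insert_sign:
  "insert_sign x xs = (s, l) \<Longrightarrow>
     wedge (map f (ys @ x # xs)) vs = of_int s * wedge (map f (ys @ l)) vs"
proof (induction x xs arbitrary: ys s l rule: insert_sign.induct)
  case (2 x y xs)
  then show ?case
    using wedge_swap_adjacent[of "map f ys" "f x" "f y" "map f xs" vs]
      wedge_repeat[of "map f ys" "f x" "map f xs" vs] "2.IH"[of _ _ "ys @ [y]"]
    by (auto split: if_splits prod.splits)
qed auto

lemma wedge_sort_sign:
  "sort_sign xs = (s, l) \<Longrightarrow>
     wedge (map f (ys @ xs)) vs = of_int s * wedge (map f (ys @ l)) vs"
proof (induction xs arbitrary: ys s l)
  case (Cons x xs)
  obtain s' l' where s': "sort_sign xs = (s', l')" by fastforce
  obtain t m where t: "insert_sign x l' = (t, m)" by fastforce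
  show ?case
    using Cons.IH[OF s', of "ys @ [x]"] wedge_insert_sign[OF t, of f ys vs] Cons.prems s' t by (auto simp flip: of_int_mult)
qed auto

lemma wedge_sort:
  "wedge (map f xs) vs = (case sort_sign xs of (s, l) \<Rightarrow> of_int s * wedge (map f l) vs)"
  using wedge_sort_sign[of xs _ _ f "[]" vs] by (auto split: prod.split)

section \<open>Multilinear functions and dual frames\<close>

text \<open>Keeps only the linearity in each slot from \<open>is_covector\<close>; this passes
  directly to functions with some arguments held fixed.\<close>

definition multilin :: "nat \<Rightarrow> covector \<Rightarrow> bool" where
  "multilin k F \<longleftrightarrow> (\<forall>vs i. length vs = k \<and> i < k \<longrightarrow> linear (\<lambda>x. F (vs[i := x])))"

lemma multilin_covector: "is_covector k \<alpha> \<Longrightarrow> multilin k \<alpha>"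
  by (simp add: is_covector_def multilin_def)

lemma multilin_append: "multilin (k + length ws) F \<Longrightarrow> multilin k (\<lambda>vs. F (vs @ ws))"
  by (auto simp: multilin_def list_update_append1[symmetric])

lemma multilin_Suc_linear:
  assumes "multilin (Suc k) F" "length vs = k"
  shows "linear (\<lambda>x. F (x # vs))"
proof -
  have "linear (\<lambda>x. F ((0 # vs)[0 := x]))"
    using assms unfolding multilin_def by (metis length_Cons zero_less_Suc)
  then show ?thesis by simp
qed

lemma multilin_Suc_multilin:
  assumes "multilin (Suc k) F"
  shows "multilin k (\<lambda>vs. F (x # vs))"
  unfolding multilin_def
proof (intro allI impI)
  fix vs :: "vec7 list" and i assume "length vs = k \<and> i < k"
  then have "linear (\<lambda>y. F ((x # vs)[Suc i := y]))"
    using assms unfolding multilin_def by (metis length_Cons Suc_less_eq)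
  then show "linear (\<lambda>y. F (x # vs[i := y]))" by simp
qed

definition dual_frames :: "(7 \<Rightarrow> vec7 \<Rightarrow> real) \<Rightarrow> (7 \<Rightarrow> vec7) \<Rightarrow> bool" where
  "dual_frames \<theta> b \<longleftrightarrow> (\<forall>i. linear (\<theta> i)) \<and> (\<forall>i j. \<theta> i (b j) = (if i = j then 1 else 0))"

text \<open>Duality says that the matrix of \<open>\<theta>\<close> is a left inverse of the matrix
  of \<open>b\<close>. For square matrices it is then also a right inverse, which is the
  expansion.\<close>

lemma dual_frames_expand:
  assumes "dual_frames \<theta> b"
  shows "v = (\<Sum>i\<in>UNIV. \<theta> i v *\<^sub>R b i)"
proof -
  define \<Theta> :: "real^7^7" where "\<Theta> = (\<chi> i j. \<theta> i (axis j 1))"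
  define B :: "real^7^7" where "B = (\<chi> i j. vec_nth (b j) i)"
  have \<theta>: "\<theta> i v = (\<Sum>j\<in>UNIV. vec_nth v j * \<theta> i (axis j 1))" for i v
  proof -
    have "\<theta> i v = \<theta> i (\<Sum>j\<in>UNIV. vec_nth v j *\<^sub>R axis j 1)"
      using basis_expansion[of v] by (simp add: scalar_mult_eq_scaleR)
    then show ?thesis
      using assms by (simp add: dual_frames_def linear_sum linear_scale)
  qed
  have "\<Theta> ** B = Finite_Cartesian_Product.mat 1"
    using assms \<theta>[of _ "b _"]
    by (simp add: Finite_Cartesian_Product.vec_eq_iff matrix_matrix_mult_def \<Theta>_def B_def Finite_Cartesian_Product.mat_def dual_frames_def mult.commute)
  then have "B ** \<Theta> = Finite_Cartesian_Product.mat 1"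
    by (simp add: matrix_left_right_inverse)
  then have "v = B *v (\<Theta> *v v)"
    by (simp add: matrix_vector_mul_assoc)
  also have "\<dots> = (\<Sum>i\<in>UNIV. \<theta> i v *\<^sub>R b i)"
    unfolding \<theta>[of _ v]
    by (simp add: Finite_Cartesian_Product.vec_eq_iff matrix_vector_mult_def \<Theta>_def B_def mult.commute)
  finally show ?thesis .
qed

lemma multilin_ext:
  assumes "dual_frames \<theta> b"
  shows "multilin k F \<Longrightarrow> \<forall>is. length is = k \<longrightarrow> F (map b is) = 0 \<Longrightarrow> length vs = k \<Longrightarrow> F vs = 0"
proof (induction k arbitrary: F vs)
  case (Suc k)
  then obtain v ws where vs: "vs = v # ws" "length ws = k"
    by (metis length_Suc_conv)
  have "F (b i # ws) = 0" for i
  proof (rule Suc.IH[OF multilin_Suc_multilin[OF Suc.prems(1)] _ vs(2)])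
    show "\<forall>is. length is = k \<longrightarrow> F (b i # map b is) = 0"
      using Suc.prems(2) by (metis length_Cons list.simps(9))
  qed
  moreover have "F vs = F ((\<Sum>i\<in>UNIV. \<theta> i v *\<^sub>R b i) # ws)"
    using dual_frames_expand[OF assms, of v] vs by simp
  ultimately show ?case
    using multilin_Suc_linear[OF Suc.prems(1) vs(2)]
      linear_sum[OF multilin_Suc_linear[OF Suc.prems(1) vs(2)], of "\<lambda>i. \<theta> i v *\<^sub>R b i" UNIV]
    by (simp add: linear_scale[OF multilin_Suc_linear[OF Suc.prems(1) vs(2)]])
qed simp

lemma sum_lists_Suc:
  fixes F :: "'a::finite list \<Rightarrow> 'b::comm_monoid_add"
  shows "(\<Sum>is | length is = Suc k. F is) = (\<Sum>i\<in>UNIV. \<Sum>is | length is = k. F (i # is))"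
proof -
  have "{is :: 'a list. length is = Suc k} = (\<lambda>(i, is). i # is) ` (UNIV \<times> {is. length is = k})"
    by (auto simp: length_Suc_conv image_iff)
  moreover have "inj_on (\<lambda>(i, is). i # is) (UNIV \<times> {is :: 'a list. length is = k})"
    by (auto simp: inj_on_def)
  ultimately show ?thesis
    by (simp add: sum.reindex sum.cartesian_product case_prod_unfold o_def)
qed

section \<open>Contractions in different orthonormal bases\<close>

text \<open>The transition matrix \<open>P\<close> from \<open>b\<close> to \<open>c\<close> is
  orthogonal. The hypothesis gives orthonormal columns, and the contraction uses orthonormal
  rows.\<close>

lemma sum_orthonormal_basis:
  assumes d: "dual_frames \<theta> b" and c: "orthonormal_basis (\<lambda>u v. \<Sum>i\<in>UNIV. \<theta> i u * \<theta> i v) c"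
    and f: "linear f" and g: "linear g"
  shows "(\<Sum>i\<in>UNIV. f (c i) * g (c i) :: real) = (\<Sum>i\<in>UNIV. f (b i) * g (b i))"
proof -
  define P :: "real^7^7" where "P = (\<chi> i j. \<theta> i (c j))"
  have "Finite_Cartesian_Product.transpose P ** P = Finite_Cartesian_Product.mat 1"
    using c by (simp add: orthonormal_basis_def Finite_Cartesian_Product.vec_eq_iff matrix_matrix_mult_def
        Finite_Cartesian_Product.transpose_def P_def Finite_Cartesian_Product.mat_def)
  then have "P ** Finite_Cartesian_Product.transpose P = Finite_Cartesian_Product.mat 1"
    by (simp add: matrix_left_right_inverse)
  then have P: "(\<Sum>i\<in>UNIV. \<theta> j (c i) * \<theta> k (c i)) = (if j = k then 1 else 0)" for j k
    unfolding Finite_Cartesian_Product.vec_eq_iff matrix_matrix_mult_def Finite_Cartesian_Product.transpose_def P_def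
      Finite_Cartesian_Product.mat_def by simp
  have ex: "h (c i) = (\<Sum>j\<in>UNIV. \<theta> j (c i) * h (b j))" if "linear h" for h :: "vec7 \<Rightarrow> real" and i
  proof -
    have "h (c i) = h (\<Sum>j\<in>UNIV. \<theta> j (c i) *\<^sub>R b j)"
      using dual_frames_expand[OF d, of "c i"] by simp
    then show ?thesis
      using that by (simp add: linear_sum linear_scale)
  qed
  have "(\<Sum>i\<in>UNIV. f (c i) * g (c i)) =
      (\<Sum>i\<in>UNIV. \<Sum>j\<in>UNIV. \<Sum>k\<in>UNIV. f (b j) * g (b k) * (\<theta> j (c i) * \<theta> k (c i)))"
    unfolding ex[OF f] ex[OF g] by (simp add: sum_product mult_ac)
  also have "\<dots> = (\<Sum>j\<in>UNIV. \<Sum>k\<in>UNIV. \<Sum>i\<in>UNIV. f (b j) * g (b k) * (\<theta> j (c i) * \<theta> k (c i)))"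
    by (subst sum.swap) (intro sum.cong refl sum.swap)
  also have "\<dots> = (\<Sum>j\<in>UNIV. f (b j) * g (b j))"
    by (simp add: sum_distrib_left[symmetric] P if_distrib cong: if_cong)
  finally show ?thesis .
qed

text \<open>The basis is changed one slot at a time. This is what frees \<open>hodge\<close> from
  the basis picked by \<open>SOME\<close>.\<close>

lemma sum_orthonormal_lists:
  assumes d: "dual_frames \<theta> b" and c: "orthonormal_basis (\<lambda>u v. \<Sum>i\<in>UNIV. \<theta> i u * \<theta> i v) c"
  shows "multilin k F \<Longrightarrow> multilin k G \<Longrightarrow>
    (\<Sum>is | length is = k. F (map c is) * G (map c is)) =
    (\<Sum>is | length is = k. F (map b is) * G (map b is))"
proof (induction k arbitrary: F G)
  case (Suc k)
  have "(\<Sum>is | length is = Suc k. F (map c is) * G (map c is)) =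
     (\<Sum>i\<in>UNIV. \<Sum>is | length is = k. F (c i # map b is) * G (c i # map b is))"
    using Suc.IH[OF multilin_Suc_multilin[OF Suc.prems(1)] multilin_Suc_multilin[OF Suc.prems(2)]]
    by (simp add: sum_lists_Suc)
  also have "\<dots> = (\<Sum>is | length is = k. \<Sum>i\<in>UNIV. F (c i # map b is) * G (c i # map b is))"
    by (rule sum.swap)
  also have "\<dots> = (\<Sum>is | length is = k. \<Sum>i\<in>UNIV. F (b i # map b is) * G (b i # map b is))"
    by (intro sum.cong refl sum_orthonormal_basis[OF d c]
        multilin_Suc_linear[OF Suc.prems(1)] multilin_Suc_linear[OF Suc.prems(2)]) auto
  also have "\<dots> = (\<Sum>is | length is = Suc k. F (map b is) * G (map b is))"
    unfolding sum_lists_Suc by (subst sum.swap) simp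
  finally show ?case .
qed simp

section \<open>Alternating sums\<close>

text \<open>Total antisymmetrisation over the arguments. Up to a factorial constant it turns a
  product of values of forms into their wedge product, which is otherwise defined for 1-covectors
  only.\<close>

definition alt_sum :: "vec7 list \<Rightarrow> ((nat \<Rightarrow> vec7) \<Rightarrow> real) \<Rightarrow> real" where
  "alt_sum vs F = (\<Sum>\<sigma> | \<sigma> permutes {..<length vs}. of_int (sign \<sigma>) * F (\<lambda>i. vs ! \<sigma> i))"

lemma alt_sum_add: "alt_sum vs (\<lambda>w. F w + G w) = alt_sum vs F + alt_sum vs G"
  by (simp add: alt_sum_def sum.distrib algebra_simps)

lemma alt_sum_diff: "alt_sum vs (\<lambda>w. F w - G w) = alt_sum vs F - alt_sum vs G"
  by (simp add: alt_sum_def sum_subtractf algebra_simps)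

lemma alt_sum_scale: "alt_sum vs (\<lambda>w. c * F w) = c * alt_sum vs F"
  by (simp add: alt_sum_def sum_distrib_left mult.left_commute)

lemma alt_sum_sum_list: "alt_sum vs (\<lambda>w. \<Sum>t\<leftarrow>ts. F t w) = (\<Sum>t\<leftarrow>ts. alt_sum vs (F t))"
  by (induction ts) (simp_all add: alt_sum_add, simp add: alt_sum_def)

text \<open>Reindexing by right composition with the transposition, which changes the sign of every
  permutation.\<close>

lemma alt_sum_transpose:
  assumes "i < length vs" "j < length vs" "i \<noteq> j"
  shows "alt_sum vs (\<lambda>w. F (w \<circ> Transposition.transpose i j)) = - alt_sum vs F"
proof -
  let ?\<tau> = "Transposition.transpose i j" and ?S = "{..<length vs}"
  have \<tau>: "?\<tau> permutes ?S"
    using assms by (intro permutes_swap_id) auto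
  have "alt_sum vs F = (\<Sum>\<sigma> | \<sigma> permutes ?S. of_int (sign (\<sigma> \<circ> ?\<tau>)) * F (\<lambda>k. vs ! (\<sigma> \<circ> ?\<tau>) k))"
    unfolding alt_sum_def by (rule sum_permutations_compose_right[OF \<tau>])
  also have "\<dots> = (\<Sum>\<sigma> | \<sigma> permutes ?S. - (of_int (sign \<sigma>) * F ((\<lambda>k. vs ! \<sigma> k) \<circ> ?\<tau>)))"
  proof (intro sum.cong refl)
    fix \<sigma> assume "\<sigma> \<in> {\<sigma>. \<sigma> permutes ?S}"
    then have "sign (\<sigma> \<circ> ?\<tau>) = sign \<sigma> * sign ?\<tau>"
      using \<tau> by (intro sign_compose permutes_imp_permutation[of ?S]) auto
    then show "of_int (sign (\<sigma> \<circ> ?\<tau>)) * F (\<lambda>k. vs ! (\<sigma> \<circ> ?\<tau>) k)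
      = - (of_int (sign \<sigma>) * F ((\<lambda>k. vs ! \<sigma> k) \<circ> ?\<tau>))"
      using assms(3) by (simp add: sign_swap_id o_def)
  qed
  finally show ?thesis
    by (simp add: alt_sum_def sum_negf)
qed

lemma alt_sum_wedge:
  "length vs = length \<theta>s \<Longrightarrow> alt_sum vs (\<lambda>w. \<Prod>i<length \<theta>s. (\<theta>s ! i) (w i)) = wedge \<theta>s vs"
  by (simp add: alt_sum_def wedge_def)

section \<open>Products of two 2-forms and a 3-form\<close>

lemma wedge_2: "wedge [a, b] [x, y] = a x * b y - a y * b x"
  by (simp add: wedge_Cons wedge_Nil)

lemma wedge_3:
  "wedge [a, b, c] [x, y, z] = a x * wedge [b, c] [y, z] - a y * wedge [b, c] [x, z] + a z * wedge [b, c] [x, y]"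
  by (simp add: wedge_Cons wedge_Nil lessThan_Suc numeral_2_eq_2 numeral_3_eq_3)

lemma wedge_3_contract:
  "wedge [a, b, c] [u, x, y] = a u * wedge [b, c] [x, y] - b u * wedge [a, c] [x, y] + c u * wedge [a, b] [x, y]"
  by (simp add: wedge_3 wedge_2 algebra_simps)

text \<open>The constant is \<open>2! 2! 3!\<close>.\<close>

lemma alt_sum_wedge_223:
  assumes "length vs = 7"
  shows "alt_sum vs (\<lambda>w. wedge [p0, p1] [w 0, w 1] * wedge [q0, q1] [w 2, w 3] *
      wedge [r0, r1, r2] [w 4, w 5, w 6]) = 24 * wedge [p0, p1, q0, q1, r0, r1, r2] vs"
proof -
  \<comment> \<open>The terms of a \<open>k\<close>-fold wedge product differ by permutations of the
    arguments of its block, so all \<open>k!\<close> of them contribute equally. This gives the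
    factors 2, 2 and 6.\<close>
  have 1: "alt_sum vs (\<lambda>w. wedge [p0, p1] [w 0, w 1] * G (w 2) (w 3) (w 4) (w 5) (w 6))
      = 2 * alt_sum vs (\<lambda>w. p0 (w 0) * p1 (w 1) * G (w 2) (w 3) (w 4) (w 5) (w 6))" for G
    using alt_sum_transpose[of 0 vs 1 "\<lambda>w. p0 (w 0) * p1 (w 1) * G (w 2) (w 3) (w 4) (w 5) (w 6)"]
    by (simp add: assms wedge_2 alt_sum_diff left_diff_distrib Transposition.transpose_def)
  have 2: "alt_sum vs (\<lambda>w. wedge [q0, q1] [w 2, w 3] * G (w 0) (w 1) (w 4) (w 5) (w 6))
      = 2 * alt_sum vs (\<lambda>w. q0 (w 2) * q1 (w 3) * G (w 0) (w 1) (w 4) (w 5) (w 6))" for G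
    using alt_sum_transpose[of 2 vs 3 "\<lambda>w. q0 (w 2) * q1 (w 3) * G (w 0) (w 1) (w 4) (w 5) (w 6)"]
    by (simp add: assms wedge_2 alt_sum_diff left_diff_distrib Transposition.transpose_def)
  have 3: "alt_sum vs (\<lambda>w. wedge [r0, r1, r2] [w 4, w 5, w 6] * G (w 0) (w 1) (w 2) (w 3))
      = 6 * alt_sum vs (\<lambda>w. r0 (w 4) * r1 (w 5) * r2 (w 6) * G (w 0) (w 1) (w 2) (w 3))" for G
  proof -
    let ?m = "\<lambda>i j k. alt_sum vs (\<lambda>w. r0 (w i) * r1 (w j) * r2 (w k) * G (w 0) (w 1) (w 2) (w 3))"
    have m: "?m 5 4 6 = - ?m 4 5 6" "?m 4 6 5 = - ?m 4 5 6" "?m 6 5 4 = - ?m 4 5 6"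
        "?m 5 6 4 = - ?m 4 6 5" "?m 6 4 5 = - ?m 5 4 6"
      using alt_sum_transpose[of 4 vs 5 "\<lambda>w. r0 (w 4) * r1 (w 5) * r2 (w 6) * G (w 0) (w 1) (w 2) (w 3)"]
        alt_sum_transpose[of 5 vs 6 "\<lambda>w. r0 (w 4) * r1 (w 5) * r2 (w 6) * G (w 0) (w 1) (w 2) (w 3)"]
        alt_sum_transpose[of 4 vs 6 "\<lambda>w. r0 (w 4) * r1 (w 5) * r2 (w 6) * G (w 0) (w 1) (w 2) (w 3)"]
        alt_sum_transpose[of 4 vs 5 "\<lambda>w. r0 (w 4) * r1 (w 6) * r2 (w 5) * G (w 0) (w 1) (w 2) (w 3)"]
        alt_sum_transpose[of 5 vs 6 "\<lambda>w. r0 (w 5) * r1 (w 4) * r2 (w 6) * G (w 0) (w 1) (w 2) (w 3)"]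
      by (simp_all add: assms Transposition.transpose_def)
    have "alt_sum vs (\<lambda>w. wedge [r0, r1, r2] [w 4, w 5, w 6] * G (w 0) (w 1) (w 2) (w 3))
      = ?m 4 5 6 - ?m 4 6 5 - ?m 5 4 6 + ?m 6 4 5 + ?m 5 6 4 - ?m 6 5 4"
      unfolding alt_sum_add[symmetric] alt_sum_diff[symmetric]
      by (rule arg_cong[where f = "alt_sum vs"]) (simp add: fun_eq_iff wedge_3 wedge_2 algebra_simps)
    then show ?thesis using m by simp
  qed
  have "alt_sum vs (\<lambda>w. wedge [p0, p1] [w 0, w 1] * wedge [q0, q1] [w 2, w 3] *
      wedge [r0, r1, r2] [w 4, w 5, w 6]) =
    24 * alt_sum vs (\<lambda>w. r0 (w 4) * r1 (w 5) * r2 (w 6) * (p0 (w 0) * p1 (w 1) * (q0 (w 2) * q1 (w 3))))"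
    using 1[of "\<lambda>w2 w3 w4 w5 w6. wedge [q0, q1] [w2, w3] * wedge [r0, r1, r2] [w4, w5, w6]"]
      2[of "\<lambda>w0 w1 w4 w5 w6. p0 w0 * p1 w1 * wedge [r0, r1, r2] [w4, w5, w6]"]
      3[of "\<lambda>w0 w1 w2 w3. p0 w0 * p1 w1 * (q0 w2 * q1 w3)"]
    by (simp add: mult_ac)
  also have "alt_sum vs (\<lambda>w. r0 (w 4) * r1 (w 5) * r2 (w 6) * (p0 (w 0) * p1 (w 1) * (q0 (w 2) * q1 (w 3))))
     = wedge [p0, p1, q0, q1, r0, r1, r2] vs"
    using alt_sum_wedge[of vs "[p0, p1, q0, q1, r0, r1, r2]"] assms
    by (simp add: lessThan_Suc eval_nat_numeral mult_ac)
  finally show ?thesis .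
qed

section \<open>The volume identity\<close>

definition g2_terms :: "(int \<times> nat list) list" where
  "g2_terms = [(1, [1,2,7]), (1, [3,4,7]), (1, [5,6,7]), (1, [1,3,5]),
     (-1, [1,4,6]), (-1, [2,3,6]), (-1, [2,4,5])]"

text \<open>The interior product with the \<open>a\<close>-th frame vector on 3-forms. The sign is
  that of moving the index \<open>a\<close> to the front.\<close>

definition contract :: "nat \<Rightarrow> (int \<times> nat list) list \<Rightarrow> (int \<times> nat list) list" where
  "contract a ts = concat (map (\<lambda>(c, is).
     if is ! 0 = a then [(c, [is ! 1, is ! 2])] else if is ! 1 = a then [(- c, [is ! 0, is ! 2])]
     else if is ! 2 = a then [(c, [is ! 0, is ! 1])] else []) ts)"

text \<open>The expansion of the wedge product of the \<open>a\<close>-th contraction, the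
  \<open>b\<close>-th contraction and the model form itself, before any sorting.\<close>

definition g2_wedge_coeffs :: "nat \<Rightarrow> nat \<Rightarrow> (int \<times> nat list) list" where
  "g2_wedge_coeffs a b = concat (map (\<lambda>(c, is). concat (map (\<lambda>(d, js). map (\<lambda>(f, ks).
     (c * d * f, is @ js @ ks)) g2_terms) (contract b g2_terms))) (contract a g2_terms))"

text \<open>The volume identity polarised on frame vectors: the 49 pairs are checked by evaluation.
  Every term either repeats an index or sorts to the volume form.\<close>

lemma sort_sign_g2_wedge_coeffs:
  "\<forall>a\<in>set [1..<8]. \<forall>b\<in>set [1..<8].
     (\<forall>(c, is)\<in>set (g2_wedge_coeffs a b). case sort_sign is of (s, l) \<Rightarrow> s = 0 \<or> l = [1..<8]) \<and>
     (\<Sum>(c, is)\<leftarrow>g2_wedge_coeffs a b. c * fst (sort_sign is)) = (if a = b then 6 else 0)"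
  by code_simp

lemma upt_1_8: "[1..<8] = [1, 2, 3, 4, 5, 6, 7::nat]"
  by (simp add: upt_rec)

lemma sum_list_7: "(\<Sum>a\<leftarrow>[1..<8]. g (of_nat a)) = (\<Sum>a\<in>UNIV. g (a :: 7))"
  by (simp only: upt_1_8 sum_7) (simp add: add.assoc)

lemma g2_model_terms:
  "g2_model \<theta> vs = (\<Sum>(c, is)\<leftarrow>g2_terms. of_int c * wedge (map (\<lambda>n. \<theta> (of_nat n)) is) vs)"
  by (simp add: g2_model_def g2_terms_def Let_def)

lemma g2_model_contract:
  "g2_model \<theta> [u, x, y] = (\<Sum>a\<leftarrow>[1..<8]. \<theta> (of_nat a) u *
     (\<Sum>(c, is)\<leftarrow>contract a g2_terms. of_int c * wedge (map (\<lambda>n. \<theta> (of_nat n)) is) [x, y]))"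
  by (simp only: upt_1_8)
    (simp add: g2_model_terms g2_terms_def contract_def wedge_3_contract algebra_simps)

lemma sum_list_triple_product:
  fixes f g h :: "_ \<Rightarrow> real"
  shows "(\<Sum>a\<leftarrow>as. x a * (\<Sum>s\<leftarrow>S a. f s)) * (\<Sum>b\<leftarrow>bs. y b * (\<Sum>t\<leftarrow>T b. g t)) * (\<Sum>r\<leftarrow>R. h r) =
    (\<Sum>a\<leftarrow>as. \<Sum>b\<leftarrow>bs. (x a * y b) * (\<Sum>s\<leftarrow>S a. \<Sum>t\<leftarrow>T b. \<Sum>r\<leftarrow>R. f s * g t * h r))"
proof -
  have "(\<Sum>s\<leftarrow>S a. \<Sum>t\<leftarrow>T b. \<Sum>r\<leftarrow>R. f s * g t * h r) =
      (\<Sum>s\<leftarrow>S a. f s) * (\<Sum>t\<leftarrow>T b. g t) * (\<Sum>r\<leftarrow>R. h r)" for a b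
    by (simp add: sum_list_const_mult sum_list_mult_const)
  moreover have "(\<Sum>a\<leftarrow>as. x a * F a) * (\<Sum>b\<leftarrow>bs. y b * G b) * H =
      (\<Sum>a\<leftarrow>as. \<Sum>b\<leftarrow>bs. (x a * y b) * (F a * G b * H))" for F G H
  proof -
    have "(x a * y b) * (F a * G b * H) = (x a * F a) * ((y b * G b) * H)" for a b
      by simp
    then show ?thesis
      by (simp only: sum_list_const_mult sum_list_mult_const)
  qed
  ultimately show ?thesis by simp
qed

lemma length_contract: "(c, is) \<in> set (contract a ts) \<Longrightarrow> length is = 2"
  by (auto simp: contract_def split: if_splits)

lemma length_g2_terms: "(c, is) \<in> set g2_terms \<Longrightarrow> length is = 3"
  by (auto simp: g2_terms_def)

lemma sum_list_concat_map:
  "(\<Sum>y\<leftarrow>concat (map f xs). g y :: real) = (\<Sum>x\<leftarrow>xs. \<Sum>y\<leftarrow>f x. g y)"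
  by (induction xs) simp_all

lemma alt_sum_wedge_terms:
  assumes "length vs = 7" "length is = 2" "length js = 2" "length ks = 3"
  shows "alt_sum vs (\<lambda>w. wedge (map f is) [w 0, w 1] * wedge (map f js) [w 2, w 3] *
      wedge (map f ks) [w 4, w 5, w 6]) = 24 * wedge (map f (is @ js @ ks)) vs"
  using assms(2-4) alt_sum_wedge_223[OF assms(1)]
  by (auto simp: length_Suc_conv eval_nat_numeral)

lemma g2_wedge_sum:
  assumes vs: "length vs = 7" and a: "a \<in> set [1..<8]" and b: "b \<in> set [1..<8]"
  shows "(\<Sum>(c, is)\<leftarrow>contract a g2_terms. \<Sum>(d, js)\<leftarrow>contract b g2_terms. \<Sum>(f, ks)\<leftarrow>g2_terms.
      of_int (c * d * f) * wedge (map \<theta> (is @ js @ ks)) vs)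
    = (if a = b then 6 else 0) * wedge (map \<theta> [1..<8]) vs"
proof -
  have "(\<Sum>(c, is)\<leftarrow>contract a g2_terms. \<Sum>(d, js)\<leftarrow>contract b g2_terms. \<Sum>(f, ks)\<leftarrow>g2_terms.
      of_int (c * d * f) * wedge (map \<theta> (is @ js @ ks)) vs)
    = (\<Sum>(c, is)\<leftarrow>g2_wedge_coeffs a b. of_int c * wedge (map \<theta> is) vs)"
    unfolding g2_wedge_coeffs_def case_prod_unfold sum_list_concat_map by (simp add: o_def)
  also have "\<dots> = (\<Sum>(c, is)\<leftarrow>g2_wedge_coeffs a b.
      of_int (c * fst (sort_sign is)) * wedge (map \<theta> [1..<8]) vs)"
  proof (intro arg_cong[where f = sum_list] map_cong refl)
    fix t assume t: "t \<in> set (g2_wedge_coeffs a b)"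
    obtain c "is" where ci: "t = (c, is)" by fastforce
    obtain s l where s: "sort_sign is = (s, l)" by fastforce
    have "s = 0 \<or> l = [1..<8]"
      using sort_sign_g2_wedge_coeffs a b t ci s by fastforce
    then show "(case t of (c, is) \<Rightarrow> of_int c * wedge (map \<theta> is) vs) = (case t of (c, is) \<Rightarrow>
      of_int (c * fst (sort_sign is)) * wedge (map \<theta> [1..<8]) vs)"
      using wedge_sort[of \<theta> "is" vs] ci s by auto
  qed
  also have "\<dots> = of_int (\<Sum>(c, is)\<leftarrow>g2_wedge_coeffs a b. c * fst (sort_sign is)) * wedge (map \<theta> [1..<8]) vs"
    by (simp add: case_prod_unfold sum_list_mult_const sum_list_of_int[symmetric] o_def)
  also have "(\<Sum>(c, is)\<leftarrow>g2_wedge_coeffs a b. c * fst (sort_sign is)) = (if a = b then 6 else 0)"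
    using sort_sign_g2_wedge_coeffs a b by blast
  finally show ?thesis by simp
qed

text \<open>The constant is 24 from the antisymmetrisation times 6 from the identity on frame
  vectors. The left-hand side depends on \<open>\<theta>\<close> only through
  \<open>g2_model \<theta>\<close>.\<close>

lemma g2_model_volume_identity:
  assumes vs: "length vs = 7"
  shows "alt_sum vs (\<lambda>w. g2_model \<theta> [u, w 0, w 1] * g2_model \<theta> [u, w 2, w 3] * g2_model \<theta> [w 4, w 5, w 6])
    = 144 * (\<Sum>a\<in>UNIV. \<theta> a u * \<theta> a u) * wedge (map \<theta> [1,2,3,4,5,6,7]) vs"
proof -
  let ?f = "\<lambda>n::nat. \<theta> (of_nat n)"
  let ?w = "\<lambda>is js ks w. wedge (map ?f is) [w 0, w 1] * wedge (map ?f js) [w 2, w 3] *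
      wedge (map ?f ks) [w 4, w 5, w 6]"
  have termwise: "of_int (fst s * fst t * fst r) * alt_sum vs (?w (snd s) (snd t) (snd r))
      = 24 * (of_int (fst s * fst t * fst r) * wedge (map ?f (snd s @ snd t @ snd r)) vs)"
    if "s \<in> set (contract a g2_terms)" "t \<in> set (contract b g2_terms)" "r \<in> set g2_terms" for a b s t r
  proof -
    have "length (snd s) = 2" "length (snd t) = 2" "length (snd r) = 3"
      using that length_contract length_g2_terms by (metis prod.collapse)+
    from alt_sum_wedge_terms[OF vs this] show ?thesis by simp
  qed
  have "alt_sum vs (\<lambda>w. g2_model \<theta> [u, w 0, w 1] * g2_model \<theta> [u, w 2, w 3] * g2_model \<theta> [w 4, w 5, w 6])
    = alt_sum vs (\<lambda>w. \<Sum>a\<leftarrow>[1..<8]. \<Sum>b\<leftarrow>[1..<8]. (?f a u * ?f b u) *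
      (\<Sum>s\<leftarrow>contract a g2_terms. \<Sum>t\<leftarrow>contract b g2_terms. \<Sum>r\<leftarrow>g2_terms.
        of_int (fst s * fst t * fst r) * ?w (snd s) (snd t) (snd r) w))"
    unfolding g2_model_contract[of \<theta> u "_ 0" "_ 1"] g2_model_contract[of \<theta> u "_ 2" "_ 3"]
      g2_model_terms[of \<theta> "[_ 4, _ 5, _ 6]"] case_prod_unfold
    by (simp only: sum_list_triple_product) (simp add: mult_ac)
  also have "\<dots> = (\<Sum>a\<leftarrow>[1..<8]. \<Sum>b\<leftarrow>[1..<8]. (?f a u * ?f b u) *
      (\<Sum>s\<leftarrow>contract a g2_terms. \<Sum>t\<leftarrow>contract b g2_terms. \<Sum>r\<leftarrow>g2_terms.
        of_int (fst s * fst t * fst r) * alt_sum vs (?w (snd s) (snd t) (snd r))))"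
    by (simp only: alt_sum_sum_list alt_sum_scale)
  also have "\<dots> = (\<Sum>a\<leftarrow>[1..<8]. \<Sum>b\<leftarrow>[1..<8]. (?f a u * ?f b u) *
      (\<Sum>s\<leftarrow>contract a g2_terms. \<Sum>t\<leftarrow>contract b g2_terms. \<Sum>r\<leftarrow>g2_terms.
        24 * (of_int (fst s * fst t * fst r) * wedge (map ?f (snd s @ snd t @ snd r)) vs)))"
    by (intro arg_cong[where f = sum_list] map_cong refl, rule arg_cong2[where f = "(*)", OF refl],
        intro arg_cong[where f = sum_list] map_cong refl, rule termwise; assumption)
  also have "\<dots> = (\<Sum>a\<leftarrow>[1..<8]. \<Sum>b\<leftarrow>[1..<8]. (?f a u * ?f b u) *
      (24 * ((if a = b then 6 else 0) * wedge (map ?f [1..<8]) vs)))"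
  proof (intro arg_cong[where f = sum_list] map_cong refl, rule arg_cong2[where f = "(*)", OF refl])
    fix a b assume "a \<in> set [1..<8]" "b \<in> set [1..<8::nat]"
    from g2_wedge_sum[OF vs this, of ?f, symmetric]
    show "(\<Sum>s\<leftarrow>contract a g2_terms. \<Sum>t\<leftarrow>contract b g2_terms. \<Sum>r\<leftarrow>g2_terms.
        24 * (of_int (fst s * fst t * fst r) * wedge (map ?f (snd s @ snd t @ snd r)) vs))
      = 24 * ((if a = b then 6 else 0) * wedge (map ?f [1..<8]) vs)"
      by (simp only: case_prod_unfold sum_list_const_mult)
  qed
  also have "\<dots> = (\<Sum>a\<leftarrow>[1..<8]. 144 * (?f a u * ?f a u) * wedge (map ?f [1..<8]) vs)"
    by (simp only: upt_1_8) simp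
  also have "\<dots> = 144 * (\<Sum>a\<leftarrow>[1..<8]. ?f a u * ?f a u) * wedge (map ?f [1..<8]) vs"
    by (simp only: sum_list_const_mult sum_list_mult_const)
  also have "(\<Sum>a\<leftarrow>[1..<8]. ?f a u * ?f a u) = (\<Sum>a\<in>UNIV. \<theta> a u * \<theta> a u)"
    by (rule sum_list_7)
  also have "map ?f [1..<8] = map \<theta> [1,2,3,4,5,6,7]"
    by (simp only: upt_1_8) simp
  finally show ?thesis .
qed

section \<open>Comparison of two adapted bases\<close>

abbreviation coframe_metric :: "(7 \<Rightarrow> vec7 \<Rightarrow> real) \<Rightarrow> vec7 \<Rightarrow> vec7 \<Rightarrow> real" where
  "coframe_metric \<theta> u v \<equiv> \<Sum>i\<in>UNIV. \<theta> i u * \<theta> i v"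

abbreviation coframe_volume :: "(7 \<Rightarrow> vec7 \<Rightarrow> real) \<Rightarrow> covector" where
  "coframe_volume \<theta> \<equiv> wedge (map \<theta> [1,2,3,4,5,6,7])"

text \<open>The frame vectors are fed in one at a time, and each cancels its dual covector at the
  front.\<close>

lemma wedge_dual_frames:
  assumes "dual_frames \<theta> b" "distinct (is @ js)"
  shows "wedge (map \<theta> (is @ js)) (map b is @ vs) = wedge (map \<theta> js) vs"
  using assms(2)
proof (induction "is")
  case (Cons i "is")
  moreover from this have "\<forall>\<eta>\<in>set (map \<theta> (is @ js)). \<eta> (b i) = 0"
    using assms(1) unfolding dual_frames_def by auto
  ultimately show ?case
    using wedge_Cons_dual[of "\<theta> i" "b i" "map \<theta> (is @ js)" "map b is @ vs"] assms(1)
    by (simp add: dual_frames_def)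
qed simp

lemma coframe_volume_frame: "dual_frames \<theta> b \<Longrightarrow> coframe_volume \<theta> (map b [1,2,3,4,5,6,7]) = 1"
  using wedge_dual_frames[of \<theta> b "[1,2,3,4,5,6,7]" "[]" "[]"] by (simp add: wedge_Nil)

lemma coframe_metric_bilinear:
  assumes "\<And>i. linear (\<theta> i)"
  shows "bilinear (coframe_metric \<theta>)"
  using assms
  by (auto simp: bilinear_def linear_iff sum.distrib[symmetric] sum_distrib_left algebra_simps)

text \<open>The matrix \<open>P\<close> of the coframe on the vectors has Gram matrix
  \<open>D\<close> times the identity; take determinants.\<close>

lemma coframe_volume_square:
  fixes b :: "7 \<Rightarrow> vec7"
  assumes D: "\<And>i j. coframe_metric \<theta> (b i) (b j) = (if i = j then D else 0)"
  shows "(coframe_volume \<theta> (map b [1,2,3,4,5,6,7]))\<^sup>2 = D ^ 7"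
proof -
  define l where "l = [1,2,3,4,5,6,7::7]"
  have l: "length l = 7" "distinct l" "sum_list (map g l) = sum g UNIV" for g :: "7 \<Rightarrow> real"
    by (simp_all add: l_def sum_7)
  define P where "P = eval_mat (map \<theta> l) (map b l)"
  have P: "P \<in> carrier_mat 7 7"
    using l(1) by (simp add: P_def eval_mat_def)
  have "transpose_mat P * P = D \<cdot>\<^sub>m 1\<^sub>m 7"
  proof (rule eq_matI)
    fix i j assume "i < dim_row (D \<cdot>\<^sub>m 1\<^sub>m 7)" "j < dim_col (D \<cdot>\<^sub>m 1\<^sub>m 7)"
    then have ij: "i < 7" "j < 7" by auto
    have "(transpose_mat P * P) $$ (i, j) = (\<Sum>k = 0..<7. \<theta> (l ! k) (b (l ! i)) * \<theta> (l ! k) (b (l ! j)))"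
      using ij l(1) by (auto simp: scalar_prod_def P_def eval_mat_def intro!: sum.cong)
    also have "\<dots> = coframe_metric \<theta> (b (l ! i)) (b (l ! j))"
      using l(3)[of "\<lambda>k. \<theta> k (b (l ! i)) * \<theta> k (b (l ! j))"] l(1)
      by (simp add: sum_list_sum_nth)
    also have "\<dots> = (if i = j then D else 0)"
      using ij l nth_eq_iff_index_eq[of l i j] by (simp add: D)
    finally show "(transpose_mat P * P) $$ (i, j) = (D \<cdot>\<^sub>m 1\<^sub>m 7) $$ (i, j)"
      using ij by simp
  qed (use P in auto)
  then have "Determinant.det (transpose_mat P * P) = Determinant.det (D \<cdot>\<^sub>m 1\<^sub>m 7)"
    by simp
  moreover have "Determinant.det (transpose_mat P * P) = Determinant.det P * Determinant.det P"
    using P by (simp add: Determinant.det_mult[of _ 7] Determinant.det_transpose)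
  moreover have "Determinant.det (D \<cdot>\<^sub>m 1\<^sub>m 7) = D ^ 7"
    by (simp add: Determinant.det_smult)
  moreover have "coframe_volume \<theta> (map b l) = Determinant.det P"
    unfolding P_def l_def by (rule wedge_det) simp
  ultimately show ?thesis by (simp add: power2_eq_square l_def)
qed

lemma g2_model_unique_metric:
  assumes d: "dual_frames \<theta> b" and d': "dual_frames \<theta>' b'" and eq: "g2_model \<theta> = g2_model \<theta>'"
  shows "orthonormal_basis (coframe_metric \<theta>) b'" "coframe_volume \<theta> (map b' [1,2,3,4,5,6,7]) = 1"
proof -
  define D where "D = coframe_volume \<theta>' (map b [1,2,3,4,5,6,7])"
  define D' where "D' = coframe_volume \<theta> (map b' [1,2,3,4,5,6,7])"
  \<comment> \<open>The alternating sum of the volume identity is the same for both coframes, since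
    it involves only the common 3-covector.\<close>
  have key: "coframe_metric \<theta> u u * coframe_volume \<theta> vs = coframe_metric \<theta>' u u * coframe_volume \<theta>' vs"
    if "length vs = 7" for u vs
    using g2_model_volume_identity[OF that, of \<theta> u] g2_model_volume_identity[OF that, of \<theta>' u] eq
    by simp
  have q: "coframe_metric \<theta> u u = D * coframe_metric \<theta>' u u" for u
    using key[of "map b [1,2,3,4,5,6,7]" u] coframe_volume_frame[OF d] by (simp add: D_def)
  have q': "coframe_metric \<theta>' u u = D' * coframe_metric \<theta> u u" for u
    using key[of "map b' [1,2,3,4,5,6,7]" u] coframe_volume_frame[OF d'] by (simp add: D'_def mult.commute)
  \<comment> \<open>Evaluating both scaling relations at this unit vector gives
    \<open>D * D' = 1\<close>.\<close>
  have one: "coframe_metric \<theta> (b 1) (b 1) = 1"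
    using d by (simp add: dual_frames_def sum_7)
  have "coframe_metric \<theta>' (b 1) (b 1) = D'"
    unfolding q'[of "b 1"] one by (rule mult_1_right)
  then have DD: "D * D' = 1"
    using q[of "b 1"] one by simp
  have lin: "linear (\<theta> i)" "linear (\<theta>' i)" for i
    using d d' by (simp_all add: dual_frames_def)
  \<comment> \<open>Polarisation extends the scaling of the quadratic forms to the bilinear
    forms.\<close>
  have pol: "2 * coframe_metric \<theta> u v =
      coframe_metric \<theta> (u + v) (u + v) - coframe_metric \<theta> u u - coframe_metric \<theta> v v"
    if "\<And>i. linear (\<theta> i)" for \<theta> :: "7 \<Rightarrow> vec7 \<Rightarrow> real" and u v
    using that by (simp add: linear_add sum.distrib sum_distrib_left algebra_simps)
  have g: "coframe_metric \<theta> u v = D * coframe_metric \<theta>' u v" for u v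
  proof -
    have "2 * coframe_metric \<theta> u v = D * (2 * coframe_metric \<theta>' u v)"
      unfolding pol[OF lin(1)] pol[OF lin(2)] q by (simp only: right_diff_distrib)
    then show ?thesis by simp
  qed
  have "coframe_metric \<theta>' (b' i) (b' j) = (if i = j then 1 else 0)" for i j
  proof -
    have "\<theta>' k (b' l) = (if k = l then 1 else 0)" for k l
      using d' by (simp add: dual_frames_def)
    then show ?thesis
      by (simp add: if_distrib[of "\<lambda>x. x * _"] cong: if_cong)
  qed
  then have b': "coframe_metric \<theta> (b' i) (b' j) = (if i = j then D else 0)" for i j
    by (simp add: g)
  then have sq: "D'\<^sup>2 = D ^ 7"
    unfolding D'_def by (intro coframe_volume_square)
  have "D ^ 9 = D\<^sup>2 * D'\<^sup>2"
    by (simp add: sq flip: power_add)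
  also have "\<dots> = 1"
    using DD by (simp flip: power_mult_distrib)
  finally have D9: "D ^ 9 = 1" .
  \<comment> \<open>\<open>D\<close> is a sum of squares; a nonnegative number whose ninth power is
    1 equals 1.\<close>
  have "0 \<le> D"
  proof -
    have "D = coframe_metric \<theta> (b' 1) (b' 1)"
      using b'[of 1 1] by simp
    then show ?thesis
      by (simp add: sum_nonneg)
  qed
  then have D: "D = 1"
    using D9 power_eq_iff_eq_base[of 9 D 1] by simp
  then show "coframe_volume \<theta> (map b' [1,2,3,4,5,6,7]) = 1"
    using DD by (simp add: D'_def)
  show "orthonormal_basis (coframe_metric \<theta>) b'"
    using b' D by (simp add: orthonormal_basis_def)
qed

section \<open>Metric, volume and Hodge star of the model form\<close>

lemma adapted_basis_iff: "adapted_basis \<alpha> b \<longleftrightarrow> (\<exists>\<theta>. dual_frames \<theta> b \<and> \<alpha> = g2_model \<theta>)"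
  by (auto simp: adapted_basis_def dual_frames_def)

lemma bilinear_frame_expand:
  assumes g: "bilinear g" and d: "dual_frames \<theta> b" and b: "orthonormal_basis g b"
  shows "g u v = coframe_metric \<theta> u v"
proof -
  have "g u v = g (\<Sum>i\<in>UNIV. \<theta> i u *\<^sub>R b i) (\<Sum>j\<in>UNIV. \<theta> j v *\<^sub>R b j)"
    using dual_frames_expand[OF d] by metis
  also have "\<dots> = (\<Sum>i\<in>UNIV. \<Sum>j\<in>UNIV. \<theta> i u * (\<theta> j v * g (b i) (b j)))"
    using bilinear_sum[OF g, of "\<lambda>i. \<theta> i u *\<^sub>R b i" UNIV "\<lambda>j. \<theta> j v *\<^sub>R b j" UNIV] g
    by (simp add: sum.cartesian_product bilinear_lmul bilinear_rmul)
  also have "\<dots> = coframe_metric \<theta> u v"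
  proof -
    have "g (b i) (b j) = (if i = j then 1 else 0)" for i j
      using b by (simp add: orthonormal_basis_def)
    then show ?thesis
      by (simp add: if_distrib[of "(*) _"] cong: if_cong)
  qed
  finally show ?thesis .
qed

text \<open>Every adapted basis is orthonormal for the coframe metric by the comparison above.
  Conversely, a bilinear form is determined by its values on the single adapted basis
  \<open>b\<close>.\<close>

lemma g2_metric_model:
  assumes "dual_frames \<theta> b"
  shows "g2_metric (g2_model \<theta>) = coframe_metric \<theta>"
  unfolding g2_metric_def
proof (rule the_equality)
  show "bilinear (coframe_metric \<theta>) \<and>
      (\<forall>b'. adapted_basis (g2_model \<theta>) b' \<longrightarrow> orthonormal_basis (coframe_metric \<theta>) b')"
    using assms g2_model_unique_metric(1)[OF assms]
    by (auto simp: adapted_basis_iff dual_frames_def intro!: coframe_metric_bilinear)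
next
  fix g assume "bilinear g \<and> (\<forall>b'. adapted_basis (g2_model \<theta>) b' \<longrightarrow> orthonormal_basis g b')"
  then show "g = coframe_metric \<theta>"
    using bilinear_frame_expand[OF _ assms] assms by (auto simp: adapted_basis_iff fun_eq_iff)
qed

section \<open>Top-degree covectors and the volume form\<close>

text \<open>Vanishing on equal arguments is applied to the sum of the two vectors and expanded by
  linearity.\<close>

lemma is_covector_swap:
  assumes \<alpha>: "is_covector k \<alpha>" and vs: "length vs = k" and ij: "i < j" "j < k"
  shows "\<alpha> (vs[i := vs ! j, j := vs ! i]) = - \<alpha> vs"
proof -
  let ?x = "vs ! i" and ?y = "vs ! j"
  let ?a = "\<lambda>x y. \<alpha> (vs[i := x, j := y])"
  have l1: "linear (\<lambda>x. ?a x y)" for y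
  proof -
    have "linear (\<lambda>x. \<alpha> ((vs[j := y])[i := x]))"
      using \<alpha> vs ij unfolding is_covector_def by (metis length_list_update less_trans)
    then show ?thesis
      using ij by (simp add: list_update_swap[of i j])
  qed
  have l2: "linear (\<lambda>y. ?a x y)" for x
    using \<alpha> vs ij unfolding is_covector_def by (metis length_list_update)
  have alt: "?a x x = 0" for x
  proof -
    have "length (vs[i := x, j := x]) = k \<and> i < j \<and> j < k \<and> vs[i := x, j := x] ! i = vs[i := x, j := x] ! j"
      using vs ij by simp
    then show ?thesis
      using \<alpha> unfolding is_covector_def by blast
  qed
  have "?a (?x + ?y) (?x + ?y) = ?a ?x ?x + ?a ?x ?y + ?a ?y ?x + ?a ?y ?y"
    by (simp add: linear_add[OF l1] linear_add[OF l2])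
  then have "?a ?y ?x = - ?a ?x ?y"
    using alt[of ?x] alt[of ?y] alt[of "?x + ?y"] by linarith
  then show ?thesis by simp
qed

text \<open>Only vanishing is tracked, so no sign has to be carried through the induction over
  transpositions.\<close>

lemma is_covector_vanish_permute:
  assumes \<alpha>: "is_covector k \<alpha>"
    and \<tau>: "\<tau> permutes {..<k}"
  shows "length vs = k \<Longrightarrow> \<alpha> vs = 0 \<Longrightarrow> \<alpha> (permute_list \<tau> vs) = 0"
  using \<tau> finite_lessThan[of k]
proof (induction \<tau> arbitrary: vs rule: permutes_induct)
  case (swap a b p)
  let ?\<tau> = "Transposition.transpose a b"
  have \<tau>: "?\<tau> permutes {..<length vs}"
    using swap by (intro permutes_swap_id) auto
  \<comment> \<open>The two indices are put in increasing order, as \<open>is_covector_swap\<close>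
    demands.\<close>
  have swp: "permute_list ?\<tau> vs = vs[i := vs ! j, j := vs ! i]"
    if "(i, j) = (min a b, max a b)" for i j
    using that swap
    by (intro nth_equalityI)
      (auto simp: permute_list_nth[OF \<tau>] Transposition.transpose_def nth_list_update min_def max_def
        split: if_splits)
  have "\<alpha> (permute_list ?\<tau> vs) = - \<alpha> vs"
    unfolding swp[OF refl] using swap by (intro is_covector_swap[OF \<alpha>]) (auto simp: min_def max_def)
  then show ?case
    using swap by (subst permute_list_compose) auto
qed auto

lemma is_covector_diff:
  "is_covector k \<alpha> \<Longrightarrow> is_covector k \<beta> \<Longrightarrow> is_covector k (\<lambda>vs. \<alpha> vs - \<beta> vs)"
  by (simp add: is_covector_def linear_compose_sub)

text \<open>By multilinearity it suffices to test the difference on frame vectors. A list with a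
  repetition gives 0 by alternation, and one without is a permutation of the standard list.\<close>

lemma top_covector_ext:
  assumes d: "dual_frames \<theta> b" and \<alpha>: "is_covector 7 \<alpha>" and \<beta>: "is_covector 7 \<beta>"
    and eq: "\<alpha> (map b [1,2,3,4,5,6,7]) = \<beta> (map b [1,2,3,4,5,6,7])"
  shows "\<alpha> = \<beta>"
proof -
  define \<gamma> where "\<gamma> vs = \<alpha> vs - \<beta> vs" for vs
  have \<gamma>: "is_covector 7 \<gamma>"
    using is_covector_diff[OF \<alpha> \<beta>] by (simp add: \<gamma>_def[abs_def])
  define l where "l = [1,2,3,4,5,6,7::7]"
  have l: "length l = 7" "distinct l" "set l = UNIV"
    by (simp_all add: l_def flip: UNIV_7)
  have "\<gamma> (map b is) = 0" if len: "length is = 7" for "is"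
  proof (cases "distinct is")
    case True
    then have "set is = UNIV"
      using len by (intro card_subset_eq) (auto simp: distinct_card)
    then have "mset is = mset l"
      using True l by (simp add: set_eq_iff_mset_eq_distinct[symmetric])
    then obtain \<tau> where \<tau>: "\<tau> permutes {..<length l}" "permute_list \<tau> l = is"
      by (metis mset_eq_permutation)
    have "\<tau> permutes {..<7}"
      using \<tau>(1) unfolding l(1) .
    moreover have "\<gamma> (map b l) = 0"
      using eq by (simp add: \<gamma>_def l_def)
    ultimately have "\<gamma> (permute_list \<tau> (map b l)) = 0"
      using l(1) by (intro is_covector_vanish_permute[OF \<gamma>]) simp_all
    then show ?thesis
      using \<tau> by (simp add: permute_list_map)
  next
    case False
    then obtain i j where "i < j" "j < 7" "is ! i = is ! j"
      using len by (metis distinct_conv_nth nat_neq_iff)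
    then have "length (map b is) = 7 \<and> i < j \<and> j < 7 \<and> map b is ! i = map b is ! j"
      using len by simp
    then show ?thesis
      using \<gamma> unfolding is_covector_def by blast
  qed
  then have "\<gamma> vs = 0" if "length vs = 7" for vs
    using multilin_ext[OF d multilin_covector[OF \<gamma>]] that by blast
  moreover have "\<gamma> vs = 0" if "length vs \<noteq> 7" for vs
    using that \<gamma> by (simp add: is_covector_def)
  ultimately have "\<gamma> vs = 0" for vs by blast
  then show ?thesis by (auto simp: \<gamma>_def)
qed

lemma is_covector_coframe:
  "dual_frames \<theta> b \<Longrightarrow> is_covector (length is) (wedge (map \<theta> is))"
  using is_covector_wedge[of "map \<theta> is"] by (simp add: dual_frames_def)

lemma g2_volume_model:
  assumes d: "dual_frames \<theta> b"
  shows "g2_volume (g2_model \<theta>) = coframe_volume \<theta>"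
  unfolding g2_volume_def
proof (rule the_equality)
  have 7: "is_covector 7 (coframe_volume \<theta>)"
    using is_covector_coframe[OF d, of "[1,2,3,4,5,6,7]"]
    by (simp add: numeral_eq_Suc)
  show "is_covector 7 (coframe_volume \<theta>) \<and>
      (\<forall>b'. adapted_basis (g2_model \<theta>) b' \<longrightarrow> coframe_volume \<theta> (map b' [1,2,3,4,5,6,7]) = 1)"
    using 7 g2_model_unique_metric(2)[OF d] by (auto simp: adapted_basis_iff)
  fix \<mu> assume "is_covector 7 \<mu> \<and>
      (\<forall>b'. adapted_basis (g2_model \<theta>) b' \<longrightarrow> \<mu> (map b' [1,2,3,4,5,6,7]) = 1)"
  then show "\<mu> = coframe_volume \<theta>"
    using d 7 coframe_volume_frame[OF d]
    by (intro top_covector_ext[OF d]) (auto simp: adapted_basis_iff)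
qed

section \<open>The Hodge star of a wedge of coframe elements\<close>

lemma permute_list_append:
  assumes "\<tau> permutes {..<length xs}"
  shows "permute_list \<tau> (xs @ ys) = permute_list \<tau> xs @ ys"
proof -
  have "\<tau> permutes {..<length (xs @ ys)}"
    using assms by (rule permutes_subset) auto
  then show ?thesis
    using assms permutes_not_in[OF assms]
    by (intro nth_equalityI) (auto simp: permute_list_nth nth_append permutes_lessThan)
qed

text \<open>For each permutation exactly one index list is carried to \<open>I\<close>. There the
  signs of the two wedge products cancel, so the \<open>k!\<close> permutations contribute
  equally.\<close>

lemma sum_wedge_frame:
  assumes d: "dual_frames \<theta> b"
  shows "(\<Sum>is | length is = length I. wedge (map \<theta> I) (map b is) * wedge \<eta>s (map b is @ ws))
    = fact (length I) * wedge \<eta>s (map b I @ ws)"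
proof -
  let ?k = "length I" and ?S = "{\<sigma>. \<sigma> permutes {..<length I}}"
  have fin: "finite {is :: 7 list. length is = n}" for n
    using finite_lists_length_eq[of "UNIV :: 7 set" n] by simp
  have w: "wedge (map \<theta> I) (map b is) * wedge \<eta>s (map b is @ ws) =
      (\<Sum>\<sigma>\<in>?S. if permute_list \<sigma> is = I then wedge \<eta>s (map b I @ ws) else 0)"
    if len: "length is = ?k" for "is"
  proof -
    have "wedge (map \<theta> I) (map b is) = (\<Sum>\<sigma>\<in>?S. of_int (sign \<sigma>) * (if permute_list \<sigma> is = I then 1 else 0))"
    proof -
      have "(\<Prod>i<?k. (map \<theta> I ! i) (map b is ! \<sigma> i)) = (if permute_list \<sigma> is = I then 1 else 0)"
        if "\<sigma> permutes {..<?k}" for \<sigma>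
      proof -
        have "(\<Prod>i<?k. (map \<theta> I ! i) (map b is ! \<sigma> i)) = (\<Prod>i<?k. if I ! i = is ! \<sigma> i then 1 else 0)"
          using d len that by (intro prod.cong) (auto simp: dual_frames_def permutes_lessThan)
        also have "\<dots> = (if permute_list \<sigma> is = I then 1 else 0)"
        proof -
          have "permute_list \<sigma> is = I \<longleftrightarrow> (\<forall>i<?k. I ! i = is ! \<sigma> i)"
            using len that by (auto simp: list_eq_iff_nth_eq permute_list_nth)
          then show ?thesis
            by (cases "\<forall>i<?k. I ! i = is ! \<sigma> i") (auto intro: prod_zero)
        qed
        finally show ?thesis .
      qed
      then show ?thesis
        using len by (simp add: wedge_def)
    qed
    moreover have "of_int (sign \<sigma>) * wedge \<eta>s (map b is @ ws) = wedge \<eta>s (map b I @ ws)"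
      if \<sigma>: "\<sigma> permutes {..<?k}" and I: "permute_list \<sigma> is = I" for \<sigma>
    proof -
      have "\<sigma> permutes {..<length (map b is @ ws)}"
        using \<sigma> by (rule permutes_subset) (simp add: len)
      from wedge_permute[OF this, of \<eta>s] show ?thesis
        using \<sigma> I len by (simp add: permute_list_append permute_list_map)
    qed
    ultimately show ?thesis
      by (auto simp: sum_distrib_right intro!: sum.cong)
  qed
  have c: "(\<Sum>is | length is = ?k. if permute_list \<sigma> is = I then x else 0) = x"
    if \<sigma>: "\<sigma> permutes {..<?k}" for \<sigma> and x :: real
  proof -
    have "permute_list \<sigma> is = I \<longleftrightarrow> is = permute_list (inv_into UNIV \<sigma>) I" if "length is = ?k" for "is"
    proof
      assume "permute_list \<sigma> is = I"
      then have "permute_list (inv_into UNIV \<sigma>) I = permute_list (\<sigma> \<circ> inv_into UNIV \<sigma>) is"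
        using permutes_inv[OF \<sigma>] that by (simp add: permute_list_compose)
      then show "is = permute_list (inv_into UNIV \<sigma>) I"
        using permutes_inv_o(1)[OF \<sigma>] by simp
    next
      assume "is = permute_list (inv_into UNIV \<sigma>) I"
      then have "permute_list \<sigma> is = permute_list (inv_into UNIV \<sigma> \<circ> \<sigma>) I"
        using \<sigma> by (simp add: permute_list_compose)
      then show "permute_list \<sigma> is = I"
        using permutes_inv_o(2)[OF \<sigma>] by simp
    qed
    then have "(\<Sum>is | length is = ?k. if permute_list \<sigma> is = I then x else 0) =
        (\<Sum>is | length is = ?k. if is = permute_list (inv_into UNIV \<sigma>) I then x else 0)"
      by (intro sum.cong) auto
    then show ?thesis
      using fin by simp
  qed
  have "(\<Sum>is | length is = ?k. wedge (map \<theta> I) (map b is) * wedge \<eta>s (map b is @ ws)) =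
      (\<Sum>\<sigma>\<in>?S. \<Sum>is | length is = ?k. if permute_list \<sigma> is = I then wedge \<eta>s (map b I @ ws) else 0)"
    using w by (subst sum.swap) simp
  also have "\<dots> = fact ?k * wedge \<eta>s (map b I @ ws)"
    using card_permutations[of "{..<?k}" ?k] by (simp add: c)
  finally show ?thesis .
qed

lemma orthonormal_basis_frame: "dual_frames \<theta> b \<Longrightarrow> orthonormal_basis (coframe_metric \<theta>) b"
  unfolding orthonormal_basis_def dual_frames_def
  by (auto simp: if_distrib[of "\<lambda>x. x * _"] cong: if_cong)

text \<open>After passing from the chosen basis to the frame, the sum over permutations of
  \<open>I\<close> cancels the factor \<open>1 / fact k\<close>. The number \<open>s\<close> relates
  the order \<open>I @ J\<close> to the orientation.\<close>

lemma hodge_wedge: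
  assumes d: "dual_frames \<theta> b" and IJ: "distinct (I @ J)" "length (I @ J) = 7"
    and vol: "\<And>vs. coframe_volume \<theta> vs = s * wedge (map \<theta> (I @ J)) vs"
  shows "hodge (coframe_metric \<theta>) (coframe_volume \<theta>) (wedge (map \<theta> I)) ws = s * wedge (map \<theta> J) ws"
proof -
  define c where "c = (SOME c. orthonormal_basis (coframe_metric \<theta>) c)"
  have c: "orthonormal_basis (coframe_metric \<theta>) c"
    unfolding c_def by (rule someI[of _ b]) (rule orthonormal_basis_frame[OF d])
  let ?k = "7 - length ws"
  have h: "hodge (coframe_metric \<theta>) (coframe_volume \<theta>) (wedge (map \<theta> I)) ws =
     s * (1 / fact ?k) * (\<Sum>is | length is = ?k. wedge (map \<theta> I) (map c is) * wedge (map \<theta> (I @ J)) (map c is @ ws))"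
    unfolding hodge_def c_def[symmetric] Let_def vol by (simp add: sum_distrib_left mult_ac)
  show ?thesis
  proof (cases "length ws = length J")
    case True
    then have k: "?k = length I" using IJ(2) by simp
    have "multilin (length I) (wedge (map \<theta> I))"
      by (intro multilin_covector is_covector_coframe[OF d])
    moreover have "multilin (length I) (\<lambda>vs. wedge (map \<theta> (I @ J)) (vs @ ws))"
      using multilin_covector[OF is_covector_coframe[OF d, of "I @ J"]] True
      by (intro multilin_append) simp
    ultimately have "(\<Sum>is | length is = length I. wedge (map \<theta> I) (map c is) * wedge (map \<theta> (I @ J)) (map c is @ ws))
        = (\<Sum>is | length is = length I. wedge (map \<theta> I) (map b is) * wedge (map \<theta> (I @ J)) (map b is @ ws))"
      by (rule sum_orthonormal_lists[OF d c])
    also have "\<dots> = fact (length I) * wedge (map \<theta> (I @ J)) (map b I @ ws)"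
      by (rule sum_wedge_frame[OF d])
    also have "wedge (map \<theta> (I @ J)) (map b I @ ws) = wedge (map \<theta> J) ws"
      by (rule wedge_dual_frames[OF d IJ(1)])
    finally show ?thesis
      unfolding h k by simp
  next
    case False
    \<comment> \<open>With a wrong number of arguments one of the two factors has a wrong length in
      each summand; this includes the case where \<open>7 - length ws\<close> is truncated to
      0.\<close>
    then have "wedge (map \<theta> I) (map c is) * wedge (map \<theta> (I @ J)) (map c is @ ws) = 0" if "length is = ?k" for "is"
      using that IJ(2) by (cases "length is = length I") (auto simp: wedge_length)
    then show ?thesis
      unfolding h using False by (simp add: wedge_length sum.neutral del: map_append)
  qed
qed

lemma hodge_add_scale:
  "hodge g \<mu> (\<lambda>vs. a * \<alpha> vs + \<beta> vs) ws = a * hodge g \<mu> \<alpha> ws + hodge g \<mu> \<beta> ws"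
  by (simp add: hodge_def Let_def distrib_right distrib_left add_divide_distrib sum.distrib
      sum_distrib_left mult_ac)

lemma hodge_0: "hodge g \<mu> (\<lambda>vs. 0) = (\<lambda>ws. 0)"
  by (simp add: hodge_def fun_eq_iff)

section \<open>Left-invariant forms on the nilpotent group\<close>

text \<open>The product rule: the derivative replaces one covector at a time.\<close>

lemma wedge_has_derivative:
  assumes "\<And>i v. i < length \<theta>s \<Longrightarrow> ((\<lambda>p. (\<theta>s ! i) p v) has_derivative (\<lambda>u. \<theta>' i u v)) (at p)"
  shows "((\<lambda>p. wedge (map (\<lambda>\<theta>. \<theta> p) \<theta>s) vs) has_derivative
    (\<lambda>u. \<Sum>i<length \<theta>s. wedge ((map (\<lambda>\<theta>. \<theta> p) \<theta>s)[i := \<theta>' i u]) vs)) (at p)"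
proof (cases "length vs = length \<theta>s")
  case True
  have "((\<lambda>p. \<Sum>\<sigma> | \<sigma> permutes {..<length \<theta>s}. of_int (sign \<sigma>) * (\<Prod>i<length \<theta>s. (\<theta>s ! i) p (vs ! \<sigma> i)))
    has_derivative (\<lambda>u. \<Sum>\<sigma> | \<sigma> permutes {..<length \<theta>s}. of_int (sign \<sigma>) * (\<Sum>i<length \<theta>s.
      \<theta>' i u (vs ! \<sigma> i) * (\<Prod>j\<in>{..<length \<theta>s} - {i}. (\<theta>s ! j) p (vs ! \<sigma> j))))) (at p)"
    by (intro has_derivative_sum has_derivative_mult_right has_derivative_prod assms) auto
  also have "(\<lambda>u. \<Sum>\<sigma> | \<sigma> permutes {..<length \<theta>s}. of_int (sign \<sigma>) * (\<Sum>i<length \<theta>s.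
      \<theta>' i u (vs ! \<sigma> i) * (\<Prod>j\<in>{..<length \<theta>s} - {i}. (\<theta>s ! j) p (vs ! \<sigma> j))))
    = (\<lambda>u. \<Sum>i<length \<theta>s. wedge ((map (\<lambda>\<theta>. \<theta> p) \<theta>s)[i := \<theta>' i u]) vs)"
    using True by (simp add: wedge_slot sum_distrib_left) (subst sum.swap, simp)
  finally show ?thesis
    using True by (simp add: wedge_def)
qed (simp add: wedge_length)

text \<open>The derivative of each factor is assumed antisymmetric in its two arguments. Its two
  halves give the same form after exchanging \<open>\<eta> i\<close> and \<open>\<zeta> i\<close>,
  whence the factor 2.\<close>

lemma ext_d_wedge:
  assumes \<theta>: "\<And>i v. i < length \<theta>s \<Longrightarrow> ((\<lambda>p. (\<theta>s ! i) p v) has_derivative (\<lambda>u. \<theta>' i u v)) (at p)"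
    and \<theta>': "\<And>i u v. i < length \<theta>s \<Longrightarrow> \<theta>' i u v = a i * (\<eta> i u * \<zeta> i v - \<zeta> i u * \<eta> i v)"
  shows "ext_d (\<lambda>p. wedge (map (\<lambda>\<theta>. \<theta> p) \<theta>s)) p vs
    = (\<Sum>i<length \<theta>s. 2 * a i * wedge (\<eta> i # (map (\<lambda>\<theta>. \<theta> p) \<theta>s)[i := \<zeta> i]) vs)"
proof -
  let ?\<theta> = "map (\<lambda>\<theta>. \<theta> p) \<theta>s" and ?del = "\<lambda>k. take k vs @ drop (Suc k) vs"
  have fd: "frechet_derivative (\<lambda>q. wedge (map (\<lambda>\<theta>. \<theta> q) \<theta>s) ws) (at p)
      = (\<lambda>u. \<Sum>i<length \<theta>s. wedge (?\<theta>[i := \<theta>' i u]) ws)" for ws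
    using frechet_derivative_at[OF wedge_has_derivative[OF \<theta>]] by simp
  have sl: "wedge (?\<theta>[i := \<theta>' i u]) ws
      = a i * \<eta> i u * wedge (?\<theta>[i := \<zeta> i]) ws - a i * \<zeta> i u * wedge (?\<theta>[i := \<eta> i]) ws"
    if "i < length \<theta>s" for i u ws
  proof -
    have "\<theta>' i u = (\<lambda>v. (a i * \<eta> i u) * \<zeta> i v + (- (a i * \<zeta> i u)) * \<eta> i v)"
      using \<theta>'[OF that] by (simp add: fun_eq_iff algebra_simps)
    then show ?thesis
      using that wedge_add_slot[of i ?\<theta> "a i * \<eta> i u" "\<zeta> i" "- (a i * \<zeta> i u)" "\<eta> i" ws] by simp
  qed
  have "ext_d (\<lambda>p. wedge (map (\<lambda>\<theta>. \<theta> p) \<theta>s)) p vs = (\<Sum>k<length vs. \<Sum>i<length \<theta>s.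
      a i * ((-1) ^ k * \<eta> i (vs ! k) * wedge (?\<theta>[i := \<zeta> i]) (?del k))
      - a i * ((-1) ^ k * \<zeta> i (vs ! k) * wedge (?\<theta>[i := \<eta> i]) (?del k)))"
    by (simp add: ext_d_def fd sl sum_distrib_left algebra_simps)
  also have "\<dots> = (\<Sum>i<length \<theta>s. a i * wedge (\<eta> i # ?\<theta>[i := \<zeta> i]) vs - a i * wedge (\<zeta> i # ?\<theta>[i := \<eta> i]) vs)"
    \<comment> \<open>The sum over \<open>k\<close> is the Laplace expansion along the covector put
      in front.\<close>
    unfolding wedge_Cons by (subst sum.swap) (simp only: sum_subtractf sum_distrib_left)
  also have "\<dots> = (\<Sum>i<length \<theta>s. 2 * a i * wedge (\<eta> i # ?\<theta>[i := \<zeta> i]) vs)"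
  proof (intro sum.cong refl)
    fix i assume "i \<in> {..<length \<theta>s}"
    then have "wedge (\<zeta> i # ?\<theta>[i := \<eta> i]) vs = - wedge (\<eta> i # ?\<theta>[i := \<zeta> i]) vs"
      using wedge_swap[of 0 "\<eta> i # ?\<theta>[i := \<zeta> i]" "Suc i" vs] by simp
    then show "a i * wedge (\<eta> i # ?\<theta>[i := \<zeta> i]) vs - a i * wedge (\<zeta> i # ?\<theta>[i := \<eta> i]) vs
        = 2 * a i * wedge (\<eta> i # ?\<theta>[i := \<zeta> i]) vs"
      by simp
  qed
  finally show ?thesis .
qed

section \<open>Symbolic left-invariant forms\<close>

lemma n_bracket_nth:
  "vec_nth (n_bracket x y) i =
    (if i = 5 then vec_nth x 2 * vec_nth y 1 - vec_nth x 1 * vec_nth y 2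
     else if i = 6 then vec_nth x 3 * vec_nth y 1 - vec_nth x 1 * vec_nth y 3 else 0)"
  by (simp add: n_bracket_def axis_def)

text \<open>Index lists of natural numbers, unlike those of type \<open>7\<close>, are evaluated by \<open>code_simp\<close>.\<close>

definition nil_coframe :: "nat \<Rightarrow> vec7 \<Rightarrow> vec7 \<Rightarrow> real" where
  "nil_coframe n p v = vec_nth (v - (1/2) *\<^sub>R n_bracket p v) (of_nat n)"

definition nil_wedge :: "nat list \<Rightarrow> dform" where
  "nil_wedge ns p = wedge (map (\<lambda>n. nil_coframe n p) ns)"

definition nil_form :: "(int \<times> nat list) list \<Rightarrow> dform" where
  "nil_form ts p vs = (\<Sum>(c, ns)\<leftarrow>ts. of_int c * nil_wedge ns p vs)"

text \<open>This is the differential at \<open>p\<close> of the left translation taking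
  \<open>p\<close> to the identity. Its components are the covectors \<open>nil_coframe\<close>,
  which therefore are the left-invariant dual basis.\<close>

lemma left_translation_derivative:
  "frechet_derivative (N_mult (N_inv p)) (at p) = (\<lambda>v. v - (1/2) *\<^sub>R n_bracket p v)"
proof -
  have "n_bracket (- p) v = - n_bracket p v" for v
    by (simp add: Finite_Cartesian_Product.vec_eq_iff n_bracket_nth)
  then show ?thesis
    using frechet_derivative_at[OF N_mult_has_derivative[of "N_inv p" p]] by (simp add: N_inv_def)
qed

definition phi_terms :: "(int \<times> nat list) list" where
  "phi_terms = [(1, [1,4,7]), (1, [2,6,7]), (1, [3,5,7]), (1, [1,2,3]), (1, [1,5,6]), (1, [2,4,5]),
     (-1, [3,4,6])]"

lemma phi_N_terms: "phi_N = nil_form phi_terms"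
  by (simp add: fun_eq_iff phi_N_def left_inv_form_def phi_n_def Let_def nil_form_def phi_terms_def
      nil_wedge_def nil_coframe_def[abs_def] wedge_map left_translation_derivative add.assoc add_diff_eq)

text \<open>Sorts the index lists and drops vanishing terms, but does not collect equal ones; a form
  may still be represented by terms that cancel.\<close>

definition normalize_terms :: "(int \<times> nat list) list \<Rightarrow> (int \<times> nat list) list" where
  "normalize_terms ts = filter (\<lambda>(c, ns). c \<noteq> 0)
     (map (\<lambda>(c, ns). case sort_sign ns of (s, l) \<Rightarrow> (c * s, l)) ts)"

lemma nil_form_Cons: "nil_form ((c, ns) # ts) p vs = of_int c * nil_wedge ns p vs + nil_form ts p vs"
  by (simp add: nil_form_def)

lemma nil_form_Nil: "nil_form [] p vs = 0"
  by (simp add: nil_form_def)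

lemma nil_form_append: "nil_form (ss @ ts) p vs = nil_form ss p vs + nil_form ts p vs"
  by (simp add: nil_form_def)

lemma nil_form_normalize: "nil_form (normalize_terms ts) = nil_form ts"
proof -
  have "nil_form (normalize_terms ts) p vs = nil_form ts p vs" for p vs
  proof (induction ts)
    case (Cons t ts)
    obtain c ns s l where "t = (c, ns)" "sort_sign ns = (s, l)" by (metis surj_pair)
    moreover from this have "nil_wedge ns p vs = of_int s * nil_wedge l p vs"
      using wedge_sort[of "\<lambda>n. nil_coframe n p" ns vs] by (simp add: nil_wedge_def)
    ultimately show ?case
      using Cons.IH by (auto simp: normalize_terms_def nil_form_Cons)
  qed (simp add: normalize_terms_def)
  then show ?thesis by (simp add: fun_eq_iff)
qed

lemma nil_coframe_has_derivative:
  "((\<lambda>p. nil_coframe n p v) has_derivative (\<lambda>u. - (1/2) * vec_nth (n_bracket u v) (of_nat n))) (at p)"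
proof -
  have "linear (\<lambda>p. vec_nth (n_bracket p v) (of_nat n))"
    by (rule linearI) (auto simp: n_bracket_nth algebra_simps)
  from linear_imp_has_derivative[OF this] show ?thesis
    unfolding nil_coframe_def by (auto intro!: derivative_eq_intros)
qed

lemma nil_wedge_differentiable: "(\<lambda>p. nil_wedge ns p vs) differentiable at p"
proof -
  have "((\<lambda>p. wedge (map (\<lambda>\<theta>. \<theta> p) (map nil_coframe ns)) vs) has_derivative
    (\<lambda>u. \<Sum>i<length (map nil_coframe ns). wedge ((map (\<lambda>\<theta>. \<theta> p) (map nil_coframe ns))
      [i := \<lambda>v. - (1/2) * vec_nth (n_bracket u v) (of_nat (ns ! i))]) vs)) (at p)"
    by (rule wedge_has_derivative) (simp only: nth_map length_map nil_coframe_has_derivative)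
  then show ?thesis
    by (auto simp: nil_wedge_def o_def differentiable_def)
qed

text \<open>
  Moving \<open>e\<^sup>1\<close> of \<open>de\<^sup>5 = e\<^sup>1\<^sup>2\<close> or \<open>de\<^sup>6 = e\<^sup>1\<^sup>3\<close> from position \<open>i\<close> to the front absorbs the sign \<open>(-1)\<^sup>i\<close> of
  the Leibniz rule.
\<close>

definition d_term :: "nat list \<Rightarrow> (int \<times> nat list) list" where
  "d_term ns = concat (map (\<lambda>i. if ns ! i = 5 then [(1, 1 # ns[i := 2])]
     else if ns ! i = 6 then [(1, 1 # ns[i := 3])] else []) [0..<length ns])"

definition scale_terms :: "int \<Rightarrow> (int \<times> nat list) list \<Rightarrow> (int \<times> nat list) list" where
  "scale_terms c ts = map (\<lambda>(d, ns). (c * d, ns)) ts"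

definition d_terms :: "(int \<times> nat list) list \<Rightarrow> (int \<times> nat list) list" where
  "d_terms ts = concat (map (\<lambda>(c, ns). scale_terms c (d_term ns)) ts)"

lemma nil_form_scale: "nil_form (scale_terms c ts) p vs = of_int c * nil_form ts p vs"
  by (simp add: nil_form_def scale_terms_def case_prod_unfold o_def mult.assoc
      sum_list_const_mult)

lemma nil_form_concat_map: "nil_form (concat (map f is)) p vs = (\<Sum>i\<leftarrow>is. nil_form (f i) p vs)"
  by (induction "is") (simp_all add: nil_form_Nil nil_form_append)

text \<open>The embedding into type \<open>7\<close> reduces modulo 7, so indices are kept between 1
  and 7.\<close>

lemma of_nat_7_eq_iff:
  assumes "n \<in> {1..<8}"
  shows "of_nat n = (5::7) \<longleftrightarrow> n = 5" "of_nat n = (6::7) \<longleftrightarrow> n = 6"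
proof -
  have "n = 1 \<or> n = 2 \<or> n = 3 \<or> n = 4 \<or> n = 5 \<or> n = 6 \<or> n = 7"
    using assms by auto
  then show "of_nat n = (5::7) \<longleftrightarrow> n = 5" "of_nat n = (6::7) \<longleftrightarrow> n = 6"
    by (elim disjE; simp)+
qed

lemma ext_d_nil_wedge:
  assumes ns: "set ns \<subseteq> {1..<8}"
  shows "ext_d (nil_wedge ns) p vs = nil_form (d_term ns) p vs"
proof -
  \<comment> \<open>The derivative of \<open>nil_coframe\<close> 5 or 6 is half of
    \<open>e\<^sup>1\<^sup>2\<close> or \<open>e\<^sup>1\<^sup>3\<close>, and the factor 2 of
    \<open>ext_d_wedge\<close> restores the coefficient 1. For other indices \<open>a i = 0\<close>
    and the value of \<open>m i\<close> is a dummy.\<close>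
  define a where "a i = (if ns ! i = 5 \<or> ns ! i = 6 then 1/2 else 0 :: real)" for i
  define m where "m i = (if ns ! i = 5 then 2 else 3 :: nat)" for i
  have w: "nil_wedge ns = (\<lambda>p. wedge (map (\<lambda>\<theta>. \<theta> p) (map nil_coframe ns)))"
    by (simp add: fun_eq_iff nil_wedge_def o_def)
  have "ext_d (nil_wedge ns) p vs = (\<Sum>i<length ns. 2 * a i *
      wedge (nil_coframe 1 p # (map (\<lambda>\<theta>. \<theta> p) (map nil_coframe ns))[i := nil_coframe (m i) p]) vs)"
    unfolding w
  proof (subst ext_d_wedge[where a = a and \<eta> = "\<lambda>i. nil_coframe 1 p" and \<zeta> = "\<lambda>i. nil_coframe (m i) p" and
        \<theta>' = "\<lambda>i u v. - (1/2) * vec_nth (n_bracket u v) (of_nat (ns ! i))"])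
    fix i u v assume "i < length (map nil_coframe ns)"
    then have "ns ! i \<in> {1..<8}"
      using ns nth_mem by fastforce
    from of_nat_7_eq_iff[OF this]
    show "- (1/2) * vec_nth (n_bracket u v) (of_nat (ns ! i)) =
        a i * (nil_coframe 1 p u * nil_coframe (m i) p v - nil_coframe (m i) p u * nil_coframe 1 p v)"
      by (auto simp: n_bracket_nth a_def m_def nil_coframe_def field_simps)
  qed (use nil_coframe_has_derivative in simp_all)
  also have "\<dots> = (\<Sum>i<length ns. 2 * a i * nil_wedge (1 # ns[i := m i]) p vs)"
    by (simp add: nil_wedge_def map_update o_def)
  also have "\<dots> = (\<Sum>i\<leftarrow>[0..<length ns]. 2 * a i * nil_wedge (1 # ns[i := m i]) p vs)"
    by (simp add: sum.list_conv_set_nth lessThan_atLeast0 interv_sum_list_conv_sum_set_nat)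
  also have "\<dots> = nil_form (d_term ns) p vs"
    unfolding d_term_def nil_form_concat_map
    by (intro arg_cong[where f = sum_list] map_cong refl)
      (simp add: nil_form_Cons nil_form_Nil a_def m_def)
  finally show ?thesis .
qed

lemma ext_d_add_scale:
  assumes "\<And>vs. (\<lambda>p. \<alpha> p vs) differentiable at p" "\<And>vs. (\<lambda>p. \<beta> p vs) differentiable at p"
  shows "ext_d (\<lambda>p vs. c * \<alpha> p vs + \<beta> p vs) p vs = c * ext_d \<alpha> p vs + ext_d \<beta> p vs"
proof -
  have "((\<lambda>p. c * \<alpha> p ws + \<beta> p ws) has_derivative (\<lambda>u. c * frechet_derivative (\<lambda>p. \<alpha> p ws) (at p) u
      + frechet_derivative (\<lambda>p. \<beta> p ws) (at p) u)) (at p)" for ws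
    using assms by (intro derivative_intros) (auto simp: frechet_derivative_works[symmetric])
  from frechet_derivative_at[OF this, symmetric] show ?thesis
    by (simp add: ext_d_def sum.distrib sum_distrib_left algebra_simps)
qed

lemma nil_form_differentiable: "(\<lambda>p. nil_form ts p vs) differentiable at p"
proof (induction ts)
  case (Cons t ts)
  obtain c ns where "t = (c, ns)" by fastforce
  then show ?case
    using Cons.IH nil_wedge_differentiable by (auto simp: nil_form_Cons intro!: derivative_intros)
qed (simp add: nil_form_Nil)

lemma ext_d_nil_form:
  assumes "\<forall>(c, ns)\<in>set ts. set ns \<subseteq> {1..<8}"
  shows "ext_d (nil_form ts) = nil_form (d_terms ts)"
proof -
  have "ext_d (nil_form ts) p vs = nil_form (d_terms ts) p vs" for p vs
    using assms
  proof (induction ts)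
    case Nil
    then show ?case by (simp add: ext_d_def nil_form_Nil d_terms_def)
  next
    case (Cons t ts)
    obtain c ns where t: "t = (c, ns)" by fastforce
    have "ext_d (nil_form (t # ts)) p vs
        = ext_d (\<lambda>p vs. of_int c * nil_wedge ns p vs + nil_form ts p vs) p vs"
      unfolding t nil_form_Cons[abs_def] ..
    also have "\<dots> = of_int c * ext_d (nil_wedge ns) p vs + ext_d (nil_form ts) p vs"
      by (intro ext_d_add_scale nil_wedge_differentiable nil_form_differentiable)
    finally show ?case
      using Cons t by (simp add: ext_d_nil_wedge d_terms_def nil_form_append nil_form_scale)
  qed
  then show ?thesis by (simp add: fun_eq_iff)
qed

section \<open>The Laplacian of the form\<close>

definition left_inv_coframe :: "vec7 \<Rightarrow> 7 \<Rightarrow> vec7 \<Rightarrow> real" where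
  "left_inv_coframe p i v = vec_nth (v - (1/2) *\<^sub>R n_bracket p v) i"

lemma nil_coframe_conv: "nil_coframe n p = left_inv_coframe p (of_nat n)"
  by (simp add: fun_eq_iff nil_coframe_def left_inv_coframe_def)

text \<open>The linear bracket terms cancel, and the remaining double bracket vanishes by 2-step
  nilpotency.\<close>

lemma dual_frames_left_inv: "dual_frames (left_inv_coframe p) (\<lambda>i. left_inv_vf (e i) p)"
  unfolding dual_frames_def
proof (intro conjI allI)
  show "linear (left_inv_coframe p i)" for i
    by (rule linearI) (auto simp: left_inv_coframe_def n_bracket_nth algebra_simps)
  show "left_inv_coframe p i (left_inv_vf (e j) p) = (if i = j then 1 else 0)" for i j
    by (simp add: left_inv_coframe_def left_inv_vf n_bracket_nth axis_def)
qed

section \<open>The adapted coframe of the form\<close>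

text \<open>The relabelling that turns the terms 127, 347, 567, 135, -146, -236, -245 of the model
  into 147, 267, 357, 123, -165, -425, -463, which are the terms of the form up to order.\<close>

definition phi_perm :: "7 \<Rightarrow> 7" where
  "phi_perm = (\<lambda>i. i)(2 := 4, 3 := 2, 4 := 6, 5 := 3, 6 := 5)"

lemma inj_phi_perm: "phi_perm i = phi_perm j \<longleftrightarrow> i = j"
proof -
  have "\<forall>i j. phi_perm i = phi_perm j \<longrightarrow> i = j"
    unfolding forall_7 by (simp add: phi_perm_def)
  then show ?thesis by blast
qed

lemma dual_frames_phi:
  "dual_frames (left_inv_coframe p \<circ> phi_perm) ((\<lambda>i. left_inv_vf (e i) p) \<circ> phi_perm)"
  using dual_frames_left_inv[of p] by (simp add: dual_frames_def inj_phi_perm)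

lemma nil_wedge_sort: "nil_wedge ns p vs = (case sort_sign ns of (s, l) \<Rightarrow> of_int s * nil_wedge l p vs)"
  by (simp add: nil_wedge_def wedge_sort[of _ ns])

lemma phi_N_model: "phi_N p = g2_model (left_inv_coframe p \<circ> phi_perm)"
proof
  fix vs
  have "g2_model (left_inv_coframe p \<circ> phi_perm) vs =
      nil_form [(1, [1,4,7]), (1, [2,6,7]), (1, [3,5,7]), (1, [1,2,3]), (-1, [1,6,5]), (-1, [4,2,5]),
        (-1, [4,6,3])] p vs"
    by (simp add: g2_model_def Let_def nil_form_def nil_wedge_def nil_coframe_conv phi_perm_def)
  also have "\<dots> = phi_N p vs"
    unfolding phi_N_terms nil_form_normalize[symmetric, of phi_terms]
    by (subst nil_form_normalize[symmetric]) (simp add: phi_terms_def normalize_terms_def)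
  finally show "phi_N p vs = g2_model (left_inv_coframe p \<circ> phi_perm) vs" ..
qed

lemma g2_metric_phi: "g2_metric (phi_N p) = coframe_metric (left_inv_coframe p)"
  unfolding phi_N_model g2_metric_model[OF dual_frames_phi]
  by (simp add: fun_eq_iff sum_7 phi_perm_def)

text \<open>The order 1, 4, 2, 6, 3, 5, 7 has four inversions, so the orientation is the standard
  one.\<close>

lemma g2_volume_phi: "g2_volume (phi_N p) = coframe_volume (left_inv_coframe p)"
proof
  fix vs
  have "g2_volume (phi_N p) vs = nil_wedge [1,4,2,6,3,5,7] p vs"
    unfolding phi_N_model g2_volume_model[OF dual_frames_phi]
    by (simp add: nil_wedge_def nil_coframe_conv phi_perm_def)
  also have "\<dots> = nil_wedge [1,2,3,4,5,6,7] p vs"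
    by (subst nil_wedge_sort) simp
  finally show "g2_volume (phi_N p) vs = coframe_volume (left_inv_coframe p) vs"
    by (simp add: nil_wedge_def nil_coframe_conv)
qed

section \<open>Symbolic Hodge star\<close>

definition complement :: "nat list \<Rightarrow> nat list" where
  "complement ns = filter (\<lambda>n. n \<notin> set ns) [1,2,3,4,5,6,7]"

text \<open>The star of \<open>e\<^sup>I\<close> is the form of the complementary indices, with the
  sign that sorts \<open>I\<close> followed by its complement.\<close>

definition hodge_terms :: "(int \<times> nat list) list \<Rightarrow> (int \<times> nat list) list" where
  "hodge_terms ts = map (\<lambda>(c, ns). (c * fst (sort_sign (ns @ complement ns)), complement ns)) ts"

lemma map_of_nat_cong: "map (\<lambda>n. nil_coframe n p) ns = map (left_inv_coframe p) (map of_nat ns)"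
  by (simp add: nil_coframe_conv)

lemma hodge_nil_wedge:
  assumes s: "sort_sign (ns @ complement ns) = (s, [1,2,3,4,5,6,7])" "s * s = 1"
    and ns: "distinct ns" "set ns \<subseteq> {1..<8}"
  shows "hodge (coframe_metric (left_inv_coframe p)) (coframe_volume (left_inv_coframe p)) (nil_wedge ns p) vs
    = of_int s * nil_wedge (complement ns) p vs"
proof -
  let ?js = "ns @ complement ns"
  have c: "set (complement ns) = {1..<8} - set ns" "distinct (complement ns)"
  proof -
    have "complement ns = filter (\<lambda>n. n \<notin> set ns) [1..<8]"
      by (simp only: complement_def upt_1_8)
    then show "set (complement ns) = {1..<8} - set ns" "distinct (complement ns)"
      by auto
  qed
  then have js: "distinct ?js" "set ?js = {1..<8}"
    using ns by auto
  have "inj_on (of_nat :: nat \<Rightarrow> 7) {1..<8}"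
  proof -
    have "\<forall>m\<in>set [1,2,3,4,5,6,7]. \<forall>n\<in>set [1,2,3,4,5,6,7]. of_nat m = (of_nat n :: 7) \<longrightarrow> m = n"
      by simp
    moreover have "set [1,2,3,4,5,6,7::nat] = {1..<8}"
      by auto
    ultimately show ?thesis
      unfolding inj_on_def by metis
  qed
  then have d: "distinct (map of_nat ?js :: 7 list)"
    using js by (simp only: distinct_map) 
  have l: "length ?js = 7"
    using distinct_card[OF js(1)] js(2) by simp
  have vol: "coframe_volume (left_inv_coframe p) ws = of_int s * wedge (map (left_inv_coframe p) (map of_nat ?js)) ws" for ws
  proof -
    have "nil_wedge ?js p ws = of_int s * nil_wedge [1,2,3,4,5,6,7] p ws"
      using nil_wedge_sort[of ?js p ws] s by simp
    \<comment> \<open>Multiplying by \<open>s\<close> moves the sign to the other side, because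
      \<open>s * s = 1\<close>.\<close>
    then have "of_int s * nil_wedge ?js p ws = of_int (s * s) * nil_wedge [1,2,3,4,5,6,7] p ws"
      by (simp only: of_int_mult mult.assoc)
    then show ?thesis
      using s(2) by (simp add: nil_wedge_def nil_coframe_conv o_def)
  qed
  have "hodge (coframe_metric (left_inv_coframe p)) (coframe_volume (left_inv_coframe p))
      (wedge (map (left_inv_coframe p) (map of_nat ns))) vs
    = of_int s * wedge (map (left_inv_coframe p) (map of_nat (complement ns))) vs"
    using d l vol by (intro hodge_wedge[OF dual_frames_left_inv]) (simp_all only: map_append length_append length_map)
  then show ?thesis
    by (simp only: nil_wedge_def map_of_nat_cong)
qed

lemma hodge_star_nil_form:
  assumes "\<forall>(c, ns)\<in>set ts. distinct ns \<and> set ns \<subseteq> {1..<8} \<and>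
    (case sort_sign (ns @ complement ns) of (s, l) \<Rightarrow> s * s = 1 \<and> l = [1,2,3,4,5,6,7])"
  shows "hodge_star phi_N (nil_form ts) = nil_form (hodge_terms ts)"
proof -
  let ?h = "\<lambda>p. hodge (coframe_metric (left_inv_coframe p)) (coframe_volume (left_inv_coframe p))"
  have "?h p (nil_form ts p) vs = nil_form (hodge_terms ts) p vs" for p vs
    using assms
  proof (induction ts)
    case Nil
    have "nil_form [] p = (\<lambda>vs. 0)"
      by (simp add: fun_eq_iff nil_form_Nil)
    then show ?case by (simp add: hodge_0 hodge_terms_def)
  next
    case (Cons t ts)
    obtain c ns where t: "t = (c, ns)" by fastforce
    obtain s l where s: "sort_sign (ns @ complement ns) = (s, l)" by fastforce
    have "nil_form (t # ts) p = (\<lambda>vs. of_int c * nil_wedge ns p vs + nil_form ts p vs)"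
      by (simp add: fun_eq_iff t nil_form_Cons)
    then have "?h p (nil_form (t # ts) p) vs = of_int c * ?h p (nil_wedge ns p) vs + ?h p (nil_form ts p) vs"
      by (simp only: hodge_add_scale)
    also have "?h p (nil_wedge ns p) vs = of_int s * nil_wedge (complement ns) p vs"
      using Cons.prems t s by (intro hodge_nil_wedge) auto
    finally show ?case
      using Cons t s by (simp add: hodge_terms_def nil_form_Cons)
  qed
  then show ?thesis
    by (simp add: fun_eq_iff hodge_star_def g2_metric_phi g2_volume_phi)
qed

lemma nil_form_empty: "nil_form [] = (\<lambda>p vs. 0)"
  by (simp add: fun_eq_iff nil_form_Nil)

section \<open>Closedness and the Laplacian\<close>

text \<open>Differentiating \<open>e\<^sup>2\<^sup>6\<^sup>7\<close> and
  \<open>e\<^sup>3\<^sup>5\<^sup>7\<close> gives \<open>e\<^sup>1\<^sup>2\<^sup>3\<^sup>7\<close>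
  with opposite signs; in the other terms either neither 5 nor 6 occurs or an index is
  repeated.\<close>

lemma ext_d_phi: "ext_d phi_N = nil_form []"
proof -
  have "ext_d phi_N = nil_form (d_terms phi_terms)"
    unfolding phi_N_terms by (rule ext_d_nil_form) (simp add: phi_terms_def)
  also have "\<dots> = nil_form [(1, [1,2,3,7]), (-1, [1,2,3,7])]"
    by (subst nil_form_normalize[symmetric])
      (rule arg_cong[where f = nil_form], code_simp)
  also have "\<dots> = nil_form []"
    by (simp add: fun_eq_iff nil_form_Cons nil_form_Nil)
  finally show ?thesis .
qed

lemma hodge_star_phi:
  "hodge_star phi_N phi_N = nil_form [(1, [2,3,5,6]), (-1, [1,3,4,5]), (-1, [1,2,4,6]), (1, [4,5,6,7]),
     (1, [2,3,4,7]), (-1, [1,3,6,7]), (1, [1,2,5,7])]"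
proof -
  have "hodge_star phi_N (nil_form phi_terms) = nil_form (hodge_terms phi_terms)"
    by (rule hodge_star_nil_form) (simp add: phi_terms_def complement_def)
  also have "hodge_terms phi_terms = [(1, [2,3,5,6]), (-1, [1,3,4,5]), (-1, [1,2,4,6]), (1, [4,5,6,7]),
     (1, [2,3,4,7]), (-1, [1,3,6,7]), (1, [1,2,5,7])]"
    by code_simp
  finally show ?thesis
    by (simp only: phi_N_terms)
qed

lemma laplacian_phi: "laplacian phi_N phi_N = nil_form [(2, [1,2,3])]"
proof -
  have 1: "ext_d (hodge_star phi_N phi_N) = nil_form [(-1, [1,2,4,6,7]), (1, [1,3,4,5,7])]"
    unfolding hodge_star_phi
    by (subst ext_d_nil_form, simp, subst nil_form_normalize[symmetric],
        rule arg_cong[where f = nil_form], code_simp)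
  have 2: "hodge_star phi_N (nil_form [(-1, [1,2,4,6,7]), (1, [1,3,4,5,7])])
      = nil_form [(1, [3,5]), (-1, [2,6])]"
    by (subst hodge_star_nil_form, simp add: complement_def,
        rule arg_cong[where f = nil_form], code_simp)
  \<comment> \<open>Both terms give \<open>- e\<^sup>1\<^sup>2\<^sup>3\<close>, and the minus sign
    in front of the first summand of \<open>laplacian\<close> turns their sum into
    \<open>2 e\<^sup>1\<^sup>2\<^sup>3\<close>.\<close>
  have 3: "ext_d (nil_form [(1, [3,5]), (-1, [2,6])]) = nil_form [(-1, [1,2,3]), (-1, [1,2,3])]"
    by (subst ext_d_nil_form, simp, subst nil_form_normalize[symmetric],
        rule arg_cong[where f = nil_form], code_simp)
  \<comment> \<open>Since the form is closed, these make the second summand of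
    \<open>laplacian\<close> vanish.\<close>
  have 4: "hodge_star phi_N (nil_form []) = nil_form []" "ext_d (nil_form []) = nil_form []"
    by (subst hodge_star_nil_form ext_d_nil_form; simp add: hodge_terms_def d_terms_def)+
  show ?thesis
    by (simp only: fun_eq_iff laplacian_def 1 2 3 4 ext_d_phi) (simp add: nil_form_Cons nil_form_Nil)
qed

section \<open>Smoothness\<close>

text \<open>Needed for the product rule, where undifferentiated factors stand beside derivatives of
  one order less.\<close>

lemma Ck_SucD: "Ck (Suc k) f \<Longrightarrow> Ck k f"
proof (induction k arbitrary: f)
  case 0
  then show ?case
    by (simp add: continuous_at_imp_continuous_on differentiable_imp_continuous_within)
next
  case (Suc k)
  then show ?case by (metis Ck.simps(2))
qed

lemma Ck_add: "Ck k f \<Longrightarrow> Ck k g \<Longrightarrow> Ck k (\<lambda>x. f x + g x)"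
proof (induction k arbitrary: f g)
  case 0
  then show ?case by (auto intro: continuous_on_add)
next
  case (Suc k)
  have "((\<lambda>x. f x + g x) has_derivative
      (\<lambda>v. frechet_derivative f (at x) v + frechet_derivative g (at x) v)) (at x)" for x
    using Suc.prems by (intro has_derivative_add) (auto simp: frechet_derivative_works[symmetric])
  note d = this
  show ?case
    using Suc d frechet_derivative_at[OF d, symmetric] by (auto simp: differentiable_def)
qed

lemma Ck_mult:
  fixes f g :: "'a::real_normed_vector \<Rightarrow> real"
  shows "Ck k f \<Longrightarrow> Ck k g \<Longrightarrow> Ck k (\<lambda>x. f x * g x)"
proof (induction k arbitrary: f g)
  case 0
  then show ?case by (auto intro: continuous_on_mult)
next
  case (Suc k)
  have "((\<lambda>x. f x * g x) has_derivative
      (\<lambda>v. f x * frechet_derivative g (at x) v + frechet_derivative f (at x) v * g x)) (at x)" for x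
    using Suc.prems by (intro has_derivative_mult) (auto simp: frechet_derivative_works[symmetric])
  note d = this
  have "Ck k (\<lambda>x. f x * frechet_derivative g (at x) v + frechet_derivative f (at x) v * g x)" for v
    using Suc Ck_SucD[OF Suc.prems(1)] Ck_SucD[OF Suc.prems(2)] by (intro Ck_add Suc.IH) auto
  then show ?case
    using d frechet_derivative_at[OF d, symmetric] by (auto simp: differentiable_def)
qed

lemma smooth_const: "smooth (\<lambda>x. c)"
  by (simp add: smooth_def Ck_const)

lemma smooth_add: "smooth f \<Longrightarrow> smooth g \<Longrightarrow> smooth (\<lambda>x. f x + g x)"
  by (simp add: smooth_def Ck_add)

lemma smooth_mult:
  fixes f g :: "'a::real_normed_vector \<Rightarrow> real"
  shows "smooth f \<Longrightarrow> smooth g \<Longrightarrow> smooth (\<lambda>x. f x * g x)"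
  by (simp add: smooth_def Ck_mult)

lemma smooth_sum: "(\<And>i. i \<in> I \<Longrightarrow> smooth (f i)) \<Longrightarrow> smooth (\<lambda>x. \<Sum>i\<in>I. f i x)"
  by (induction I rule: infinite_finite_induct) (auto intro: smooth_const smooth_add)

lemma smooth_prod:
  fixes f :: "'i \<Rightarrow> 'a::real_normed_vector \<Rightarrow> real"
  shows "(\<And>i. i \<in> I \<Longrightarrow> smooth (f i)) \<Longrightarrow> smooth (\<lambda>x. \<Prod>i\<in>I. f i x)"
  by (induction I rule: infinite_finite_induct) (auto intro: smooth_const smooth_mult)

lemma smooth_linear_plus_const:
  fixes f :: "'a::euclidean_space \<Rightarrow> 'b::real_normed_vector"
  shows "linear f \<Longrightarrow> smooth (\<lambda>x. f x + c)"
  by (simp add: smooth_def Ck_linear_plus_const)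

lemma smooth_linear:
  fixes f :: "'a::euclidean_space \<Rightarrow> 'b::real_normed_vector"
  shows "linear f \<Longrightarrow> smooth f"
  using smooth_linear_plus_const[of f 0] by simp

lemma smooth_nil_wedge: "smooth (\<lambda>p. nil_wedge ns p vs)"
proof -
  have "smooth (\<lambda>p. nil_coframe n p v)" for n v
  proof -
    have "linear (\<lambda>p. - (1/2) * vec_nth (n_bracket p v) (of_nat n))"
      by (rule linearI) (auto simp: n_bracket_nth algebra_simps)
    from smooth_linear_plus_const[OF this, of "vec_nth v (of_nat n)"] show ?thesis
      by (simp add: nil_coframe_def algebra_simps)
  qed
  then show ?thesis
    by (cases "length vs = length ns")
      (auto simp: nil_wedge_def wedge_def intro!: smooth_sum smooth_mult smooth_const smooth_prod)
qed

lemma smooth_nil_form: "smooth (\<lambda>p. nil_form ts p vs)"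
proof (induction ts)
  case (Cons t ts)
  then show ?case
    by (cases t) (auto simp: nil_form_Cons intro!: smooth_add smooth_mult smooth_const smooth_nil_wedge)
qed (simp add: nil_form_Nil smooth_const)

lemma is_covector_add_scale:
  "is_covector k \<alpha> \<Longrightarrow> is_covector k \<beta> \<Longrightarrow> is_covector k (\<lambda>vs. c * \<alpha> vs + \<beta> vs)"
  unfolding is_covector_def by (auto intro!: linear_compose_add linear_mult_left)

lemma is_covector_nil_wedge: "is_covector (length ns) (nil_wedge ns p)"
  using is_covector_coframe[OF dual_frames_left_inv, of "map of_nat ns" p]
  by (simp only: nil_wedge_def map_of_nat_cong length_map)

lemma is_covector_nil_form:
  "\<forall>(c, ns)\<in>set ts. length ns = k \<Longrightarrow> is_covector k (nil_form ts p)"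
proof (induction ts)
  case Nil
  then show ?case by (simp add: nil_form_empty is_covector_def linear_zero)
next
  case (Cons t ts)
  obtain c ns where t: "t = (c, ns)" by fastforce
  then have "is_covector k (\<lambda>vs. of_int c * nil_wedge ns p vs + nil_form ts p vs)"
    using Cons is_covector_nil_wedge[of ns p] by (intro is_covector_add_scale) auto
  then show ?case
    by (simp add: t nil_form_Cons[abs_def])
qed

lemma g2_structure_phi: "g2_structure phi_N"
  unfolding g2_structure_def
proof (intro conjI allI)
  show "is_form 3 phi_N"
    unfolding is_form_def phi_N_terms
    by (intro conjI allI smooth_nil_form is_covector_nil_form) (simp add: phi_terms_def)
  show "\<exists>b. adapted_basis (phi_N p) b" for p
    unfolding adapted_basis_iff phi_N_model using dual_frames_phi by blast
qed

section \<open>The flow of the derivation\<close>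

text \<open>The eigenvalues of \<open>- D_n\<close>. They grade the Lie algebra: the brackets giving
  \<open>e 5\<close> and \<open>e 6\<close> involve only vectors of weight 1.\<close>

definition weight :: "7 \<Rightarrow> real" where
  "weight i = (if i = 1 \<or> i = 2 \<or> i = 3 then 1 else 2)"

lemma D_n_nth: "vec_nth (vec_nth D_n i) j = (if i = j then - weight i else 0)"
proof -
  have "\<forall>i. vec_nth (vector [1,1,1,2,2,2,2] :: real^7) i = weight i"
    unfolding forall_7 by (simp add: vector_def weight_def)
  then show ?thesis
    by (simp add: D_n_def Defs.diag_mat_def)
qed

lemma D_n_mult: "vec_nth (D_n *v p) i = - weight i * vec_nth p i"
  by (simp add: matrix_vector_mult_def D_n_nth if_distrib[of "\<lambda>x. x * _"] cong: if_cong)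

lemma derivation_D_n: "derivation D_n"
  by (simp add: derivation_def Finite_Cartesian_Product.vec_eq_iff D_n_mult n_bracket_nth weight_def
      algebra_simps)

text \<open>The exponential of \<open>t\<close> times \<open>D_n\<close> in coordinates. It is also
  the automorphism of the group, since the Baker-Campbell-Hausdorff product identifies the group
  with its Lie algebra.\<close>

definition dilation :: "real \<Rightarrow> vec7 \<Rightarrow> vec7" where
  "dilation t p = (\<chi> i. exp (- (t * weight i)) * vec_nth p i)"

lemma dilation_nth: "vec_nth (dilation t p) i = exp (- (t * weight i)) * vec_nth p i"
  by (simp add: dilation_def)

lemma linear_dilation: "linear (dilation t)"
  by (rule linearI) (auto simp: Finite_Cartesian_Product.vec_eq_iff dilation_nth algebra_simps)

lemma mat_pow_diag: "mat_pow (Defs.diag_mat d) k = Defs.diag_mat (\<chi> i. vec_nth d i ^ k)"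
proof (induction k)
  case 0
  then show ?case
    by (simp add: Defs.diag_mat_def Finite_Cartesian_Product.mat_def Finite_Cartesian_Product.vec_eq_iff)
next
  case (Suc k)
  then show ?case
    by (simp add: Defs.diag_mat_def matrix_matrix_mult_def Finite_Cartesian_Product.vec_eq_iff
        if_distrib[of "\<lambda>x. x * _"] cong: if_cong)
qed

lemma sums_vec:
  fixes f :: "nat \<Rightarrow> 'a::real_normed_vector ^ 'n"
  assumes "\<And>i. (\<lambda>k. vec_nth (f k) i) sums vec_nth l i"
  shows "f sums l"
  using assms unfolding sums_def by (intro vec_tendstoI) (simp add: sum_component)

lemma mat_exp_diag:
  fixes d :: "real^'n"
  shows "mat_exp (Defs.diag_mat d) = Defs.diag_mat (\<chi> i. exp (vec_nth d i))"
proof -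
  have "(\<lambda>k. (1 / fact k) *\<^sub>R mat_pow (Defs.diag_mat d) k) sums Defs.diag_mat (\<chi> i. exp (vec_nth d i))"
    unfolding mat_pow_diag
  proof (intro sums_vec)
    show "(\<lambda>k. vec_nth (vec_nth ((1 / fact k) *\<^sub>R Defs.diag_mat (\<chi> i. vec_nth d i ^ k)) i) j)
      sums vec_nth (vec_nth (Defs.diag_mat (\<chi> i. exp (vec_nth d i))) i) j" for i j
      using exp_converges[of "vec_nth d i"] by (cases "i = j") (simp_all add: Defs.diag_mat_def divide_inverse mult.commute)
  qed
  then show ?thesis
    by (simp add: mat_exp_def sums_iff)
qed

lemma mat_exp_D_n: "mat_exp (t *\<^sub>R D_n) *v p = dilation t p"
proof -
  have D: "t *\<^sub>R D_n = Defs.diag_mat (\<chi> i. - (t * weight i))"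
    by (simp add: Finite_Cartesian_Product.vec_eq_iff D_n_nth Defs.diag_mat_def)
  show ?thesis
    unfolding D mat_exp_diag
    by (simp add: Finite_Cartesian_Product.vec_eq_iff dilation_nth Defs.diag_mat_def
        matrix_vector_mult_def if_distrib[of "\<lambda>x. x * _"] cong: if_cong)
qed

lemma n_bracket_dilation: "n_bracket (dilation t p) (dilation t q) = dilation t (n_bracket p q)"
proof -
  have "exp (- (t * 2)) = exp (- t) * exp (- t)"
    by (simp flip: exp_add)
  then show ?thesis
    by (simp add: Finite_Cartesian_Product.vec_eq_iff n_bracket_nth dilation_nth weight_def algebra_simps)
qed

lemma N_aut_dilation: "N_aut (dilation t)"
  unfolding N_aut_def
proof (intro conjI allI)
  have inv: "dilation (- t) (dilation t p) = p" "dilation t (dilation (- t) p) = p" for p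
    by (simp_all add: Finite_Cartesian_Product.vec_eq_iff dilation_nth mult.assoc[symmetric] mult_exp_exp)
  show "bij (dilation t)"
    using inv by (intro bij_betw_byWitness[where f' = "dilation (- t)"]) auto
  have "inv_into UNIV (dilation t) = dilation (- t)"
    using inv by (intro inv_unique_comp) (auto simp: fun_eq_iff)
  then show "smooth (inv_into UNIV (dilation t))"
    by (simp add: smooth_linear linear_dilation)
  show "smooth (dilation t)"
    by (simp add: smooth_linear linear_dilation)
  show "dilation t (N_mult p q) = N_mult (dilation t p) (dilation t q)" for p q
    by (simp add: N_mult_def n_bracket_dilation linear_add[OF linear_dilation] linear_scale[OF linear_dilation])
qed

section \<open>Automorphisms are determined by their derivative at the identity\<close>

text \<open>Additivity carries the derivative at 0 to every point, so the difference from the linear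
  function is constant.\<close>

lemma additive_has_derivative:
  fixes f :: "real \<Rightarrow> real"
  assumes add: "\<And>s r. f (s + r) = f s + f r" and d: "(f has_real_derivative w) (at 0)"
  shows "f s = s * w"
proof -
  have "(f has_real_derivative w) (at x)" for x
  proof -
    have "((\<lambda>y. f x + f (y - x)) has_real_derivative w) (at x)"
      using d by (auto intro!: derivative_eq_intros DERIV_chain2[where g = "\<lambda>y. y - x" and f = f])
    moreover have "(\<lambda>y. f x + f (y - x)) = f"
      by (simp add: fun_eq_iff flip: add)
    ultimately show ?thesis by simp
  qed
  then have "((\<lambda>y. f y - y * w) has_real_derivative 0) (at x)" for x
    by (auto intro!: derivative_eq_intros)
  then have "f s - s * w = f 0 - 0 * w"
    by (intro DERIV_isconst_all[of "\<lambda>y. f y - y * w"]) auto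
  moreover have "f 0 = 0"
    using add[of 0 0] by simp
  ultimately show ?thesis by simp
qed

text \<open>Outside the central coordinates 5 and 6 the curve is additive, hence linear. Then its
  values have zero bracket with each other, which makes coordinates 5 and 6 additive as
  well.\<close>

lemma N_one_parameter_subgroup:
  assumes hom: "\<And>s r. c (s + r) = N_mult (c s) (c r)" and d: "(c has_vector_derivative w) (at 0)"
  shows "c s = s *\<^sub>R w"
proof -
  have di: "((\<lambda>s. vec_nth (c s) i) has_real_derivative vec_nth w i) (at 0)" for i
    using bounded_linear.has_vector_derivative[OF bounded_linear_vec_nth d]
    by (simp add: has_real_derivative_iff_has_vector_derivative)
  have c: "vec_nth (c s) i = s * vec_nth w i" if "i \<noteq> 5" "i \<noteq> 6" for i s
    using that by (intro additive_has_derivative di) (simp add: hom N_mult_def n_bracket_nth)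
  have "n_bracket (c s) (c r) = 0" for s r
    by (simp add: Finite_Cartesian_Product.vec_eq_iff n_bracket_nth c)
  then have "vec_nth (c s) i = s * vec_nth w i" for i
    by (intro additive_has_derivative di) (simp add: hom N_mult_def)
  then show ?thesis
    by (simp add: Finite_Cartesian_Product.vec_eq_iff)
qed

text \<open>An automorphism sends the one-parameter subgroup through \<open>p\<close> to another
  one, which its velocity at 0 determines; then put \<open>s = 1\<close>. This makes the
  \<open>THE\<close> in \<open>aut_of\<close> well defined.\<close>

lemma N_aut_unique:
  assumes F: "N_aut F" and d: "(F has_derivative A) (at 0)"
  shows "F = A"
proof
  fix p
  have hom: "F ((s + r) *\<^sub>R p) = N_mult (F (s *\<^sub>R p)) (F (r *\<^sub>R p))" for s r
  proof -
    have "N_mult (s *\<^sub>R p) (r *\<^sub>R p) = (s + r) *\<^sub>R p"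
      by (simp add: N_mult_def Finite_Cartesian_Product.vec_eq_iff n_bracket_nth algebra_simps)
    then show ?thesis
      using F by (metis N_aut_def)
  qed
  have "(F \<circ> (\<lambda>s. s *\<^sub>R p) has_derivative A \<circ> (\<lambda>s. s *\<^sub>R p)) (at 0)"
    by (rule diff_chain_at) (use d in \<open>auto intro!: derivative_eq_intros\<close>)
  moreover have "linear A"
    using d by (rule has_derivative_linear)
  ultimately have "((\<lambda>s. F (s *\<^sub>R p)) has_vector_derivative A p) (at 0)"
    by (simp add: has_vector_derivative_def o_def linear_scale)
  from N_one_parameter_subgroup[OF hom this, of 1] show "F p = A p"
    by simp
qed

lemma aut_of_D_n: "aut_of D_n t = dilation t"
  unfolding aut_of_def mat_exp_D_n
  using N_aut_dilation N_aut_unique linear_imp_has_derivative[OF linear_dilation]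
  by (intro the_equality) auto

section \<open>The flow and the Lie derivative\<close>

lemma has_vector_derivative_vec:
  fixes c :: "real \<Rightarrow> real^'n"
  assumes "\<And>i. ((\<lambda>s. vec_nth (c s) i) has_real_derivative vec_nth w i) (at t)"
  shows "(c has_vector_derivative w) (at t)"
proof -
  have "((\<lambda>s. vec_nth (c s) i) has_derivative (\<lambda>x. x * vec_nth w i)) (at t)" for i
    using assms[of i] by (simp add: has_field_derivative_def mult_commute_abs)
  then show ?thesis
    unfolding has_vector_derivative_def
    by (subst has_derivative_componentwise_within) (auto simp: Basis_vec_def inner_axis)
qed

lemma dilation_integral_curve: "integral_curve (\<lambda>p. D_n *v p) (\<lambda>t. dilation t p)"
  unfolding integral_curve_def
proof
  show "((\<lambda>t. dilation t p) has_vector_derivative D_n *v dilation t p) (at t)" for t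
    by (rule has_vector_derivative_vec)
      (auto simp: dilation_nth D_n_mult intro!: derivative_eq_intros)
qed

lemma dilation_0: "dilation 0 p = p"
  by (simp add: Finite_Cartesian_Product.vec_eq_iff dilation_nth)

lemma vf_of_D_n: "vf_of D_n = (\<lambda>p. D_n *v p)"
proof
  fix p
  have "((\<lambda>t. dilation t p) has_vector_derivative D_n *v p) (at 0)"
    using dilation_integral_curve[of p] dilation_0[of p] unfolding integral_curve_def by metis
  then show "vf_of D_n p = D_n *v p"
    by (simp add: vf_of_def aut_of_D_n vector_derivative_at)
qed

text \<open>Each coordinate times the integrating factor \<open>exp (s * weight i)\<close> has
  derivative 0 and is constant.\<close>

lemma integral_curve_D_n_unique:
  assumes \<gamma>: "integral_curve (\<lambda>p. D_n *v p) \<gamma>" and 0: "\<gamma> 0 = p"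
  shows "\<gamma> = (\<lambda>t. dilation t p)"
proof
  fix t
  have "vec_nth (\<gamma> t) i = exp (- (t * weight i)) * vec_nth p i" for i
  proof -
    have d: "((\<lambda>s. vec_nth (\<gamma> s) i) has_real_derivative - weight i * vec_nth (\<gamma> s) i) (at s)" for s
    proof -
      have "(\<gamma> has_vector_derivative D_n *v \<gamma> s) (at s)"
        using \<gamma> by (simp add: integral_curve_def)
      from bounded_linear.has_vector_derivative[OF bounded_linear_vec_nth this, of i] show ?thesis
        by (simp add: has_real_derivative_iff_has_vector_derivative D_n_mult)
    qed
    have "((\<lambda>s. vec_nth (\<gamma> s) i * exp (s * weight i)) has_real_derivative 0) (at s)" for s
      using d[of s] by (auto intro!: derivative_eq_intros)
    then have "vec_nth (\<gamma> t) i * exp (t * weight i) = vec_nth (\<gamma> 0) i * exp (0 * weight i)"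
      by (intro DERIV_isconst_all[of "\<lambda>s. vec_nth (\<gamma> s) i * exp (s * weight i)"]) auto
    then show ?thesis
      using 0 by (simp add: exp_minus field_simps)
  qed
  then show "\<gamma> t = dilation t p"
    by (simp add: Finite_Cartesian_Product.vec_eq_iff dilation_nth)
qed

lemma flow_D_n: "flow (vf_of D_n) t = dilation t"
proof
  fix p
  have "(THE \<gamma>. integral_curve (\<lambda>p. D_n *v p) \<gamma> \<and> \<gamma> 0 = p) = (\<lambda>t. dilation t p)"
    using dilation_integral_curve dilation_0 integral_curve_D_n_unique by (intro the_equality) auto
  then show "flow (vf_of D_n) t p = dilation t p"
    by (simp add: flow_def vf_of_D_n)
qed

lemma complete_vf_of_D_n: "complete_vector_field (vf_of D_n)"
  unfolding complete_vector_field_def vf_of_D_n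
  using dilation_integral_curve dilation_0 smooth_linear[OF matrix_vector_mul_linear] by blast

lemma nil_coframe_dilation:
  "nil_coframe n (dilation t p) (dilation t v) = exp (- (t * weight (of_nat n))) * nil_coframe n p v"
  by (simp add: nil_coframe_def n_bracket_dilation dilation_nth algebra_simps)

lemma pullback_dilation_nil_wedge:
  "nil_wedge ns (dilation t p) (map (dilation t) vs)
    = (\<Prod>n\<leftarrow>ns. exp (- (t * weight (of_nat n)))) * nil_wedge ns p vs"
  by (simp add: nil_wedge_def wedge_map o_def nil_coframe_dilation wedge_scale)

lemma lie_derivative_phi:
  "lie_derivative (vf_of D_n) phi_N p vs = - 5 * phi_N p vs + 2 * nil_wedge [1,2,3] p vs"
proof -
  have fd: "frechet_derivative (dilation t) (at p) = dilation t" for t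
    using frechet_derivative_at[OF linear_imp_has_derivative[OF linear_dilation]] by metis
  have "pullback (flow (vf_of D_n) t) phi_N p vs =
      exp (- (5 * t)) * (phi_N p vs - nil_wedge [1,2,3] p vs) + exp (- (3 * t)) * nil_wedge [1,2,3] p vs" for t
    by (simp add: pullback_def flow_D_n fd phi_N_terms phi_terms_def nil_form_Cons nil_form_Nil
        pullback_dilation_nil_wedge weight_def mult_exp_exp algebra_simps)
  then have "lie_derivative (vf_of D_n) phi_N p vs = deriv (\<lambda>t. exp (- (5 * t)) *
      (phi_N p vs - nil_wedge [1,2,3] p vs) + exp (- (3 * t)) * nil_wedge [1,2,3] p vs) 0"
    by (simp add: lie_derivative_def)
  also have "\<dots> = - 5 * phi_N p vs + 2 * nil_wedge [1,2,3] p vs"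
    \<comment> \<open>The derivative at 0 is -5 times the part of weight 5 plus -3 times the part of
      weight 3.\<close>
    by (rule DERIV_imp_deriv) (auto intro!: derivative_eq_intros simp: algebra_simps)
  finally show ?thesis .
qed

lemma soliton_equation:
  "laplacian phi_N phi_N = (\<lambda>p vs. 5 * phi_N p vs + lie_derivative (vf_of D_n) phi_N p vs)"
  by (simp add: fun_eq_iff laplacian_phi lie_derivative_phi nil_form_Cons nil_form_Nil)

text \<open>At the identity, \<open>e\<^sup>1\<^sup>2\<^sup>3\<close> vanishes on
  \<open>e 1\<close>, \<open>e 4\<close>, \<open>e 7\<close> while the form takes the value 1, so
  \<open>c = 0\<close>; but \<open>2 e\<^sup>1\<^sup>2\<^sup>3\<close> does not vanish on
  \<open>e 1\<close>, \<open>e 2\<close>, \<open>e 3\<close>.\<close>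

lemma laplacian_phi_not_multiple: "laplacian phi_N phi_N \<noteq> (\<lambda>p vs. c * phi_N p vs)"
proof
  assume "laplacian phi_N phi_N = (\<lambda>p vs. c * phi_N p vs)"
  then have eq: "2 * nil_wedge [1,2,3] 0 vs = c * phi_N 0 vs" for vs
    by (simp add: fun_eq_iff laplacian_phi nil_form_Cons nil_form_Nil)
  have n: "nil_coframe n 0 v = vec_nth v (of_nat n)" for n v
    by (simp add: nil_coframe_def n_bracket_nth)
  have "c = 0"
    using eq[of "[e 1, e 4, e 7]"]
    by (simp add: phi_N_terms phi_terms_def nil_form_Cons nil_form_Nil nil_wedge_def wedge_3 wedge_2 n axis_def)
  then show False
    using eq[of "[e 1, e 2, e 3]"]
    by (simp add: nil_wedge_def wedge_3 wedge_2 n axis_def)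
qed

theorem mainTheorem4:
  "g2_structure phi_N \<and>
   closed_form phi_N \<and>
   derivation D_n \<and>
   laplacian phi_N phi_N = (\<lambda>p vs. 5 * phi_N p vs + lie_derivative (vf_of D_n) phi_N p vs) \<and>
   expanding_soliton phi_N \<and>
   \<not> (\<exists>c. laplacian phi_N phi_N = (\<lambda>p vs. c * phi_N p vs))"
proof -
  have "closed_form phi_N"
    by (simp add: closed_form_def ext_d_phi nil_form_empty)
  moreover have "expanding_soliton phi_N"
    unfolding expanding_soliton_def laplacian_soliton_def
    using g2_structure_phi complete_vf_of_D_n soliton_equation
    by (intro exI[of _ 5] exI[of _ "vf_of D_n"]) auto
  ultimately show ?thesis
    using g2_structure_phi derivation_D_n soliton_equation laplacian_phi_not_multiple by blast
qed

end
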